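(* Let $G$ be a finite connected graph without loops or multiple edges, with $m$ edges, and let $w$ be a quaternionic weight on its arcs. Then \[ {\bf Z}_{\mathbb{H}}(G,w,t)^{-1}=\mathrm{Sdet}_t\bigl({\bf I}_{2m}-({\bf B}_w-{\bf J}_w)t\bigr). \]
   Context: $\mathbb{H}$ is the real quaternion algebra, $\mathbb{C}=\mathbb{R}+\mathbb{R}i\subset\mathbb{H}$, $x^*=x_0-x_1i-x_2j-x_3k$ for $x=x_0+x_1i+x_2j+x_3k$. $\mathbb{H}[[t]]$ is the ring of formal power series in a central indeterminate $t$, $\alpha^*=\sum\alpha_k^*t^k$. Study determinant: each quaternionic matrix is uniquely ${\bf M}={\bf M}^S+j{\bf M}^P$ with complex ${\bf M}^S,{\bf M}^P$; $\psi({\bf M})=\begin{bmatrix}{\bf M}^S&-\overline{{\bf M}^P}\\ {\bf M}^P&\overline{{\bf M}^S}\end{bmatrix}$; for a square matrix ${\bf M}=\sum_k{\bf M}_kt^k$ over $\mathbb{H}[[t]]$, $\psi_t({\bf M})=\sum_k\psi({\bf M}_k)t^k$ and $\mathrm{Sdet}_t({\bf M})=\det(\psi_t({\bf M}))\in\mathbb{C}[[t]]$. Graph notions: $D(G)$ is the set of arcs ($|D(G)|=2m$), $o(e),t(e)$ origin and terminus, $e^{-1}$ the reverse arc; arcs are enumerated $e_1,\dots,e_{2m}$ with $e_{m+k}=e_k^{-1}$, and $2m\times 2m$ matrices are indexed by arcs in this order. A quaternionic weight is $w:V(G)\times V(G)\to\mathbb{H}$ vanishing off $D(G)$, $w(e)=w(u,v)$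 for $e=(u,v)$; for a path $P=(f_1,\dots,f_\ell)$, $w(P)=w(f_1)\cdots w(f_\ell)$ and $|P|=\ell$. A cycle is a path with $t(f_\ell)=o(f_1)$; it has a backtracking if $f_{i+1}=f_i^{-1}$ for some $i$; it is reduced if neither $C$ nor $C^2$ has a backtracking. $L_{[2m]}$ is the set of Lyndon words over $\{1<\dots<2m\}$. ${\bf Z}_{\mathbb{H}}(G,w,t)=\prod_{C}\{(1-w(C)t^{|C|})(1-w(C)t^{|C|})^*\}^{-1}$, where $C$ runs over reduced cycles $(e_{i_1},\dots,e_{i_r})$ with $i_1\cdots i_r\in L_{[2m]}$. ${\bf B}_w=({\bf B}^{(w)}_{ef})$ and ${\bf J}_w=({\bf J}^{(w)}_{ef})$ are the $2m\times 2m$ matrices indexed by $e,f\in D(G)$ with ${\bf B}^{(w)}_{ef}=w(e)$ if $t(e)=o(f)$ and $0$ otherwise, ${\bf J}^{(w)}_{ef}=w(e)$ if $f=e^{-1}$ and $0$ otherwise. *)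

theory Defs
  imports
    Complex_Main
    "HOL-Computational_Algebra.Formal_Power_Series"
    "Jordan_Normal_Form.Determinant"
    "Graph_Theory.Graph_Theory"
begin

section \<open>Quaternions\<close>

text \<open>\<open>Quat x0 x1 x2 x3\<close> stands for \<open>x0 + x1 i + x2 j + x3 k\<close>.\<close>

datatype quat = Quat (q0: real) (q1: real) (q2: real) (q3: real)

lemma quat_eq_iff: "x = y \<longleftrightarrow> q0 x = q0 y \<and> q1 x = q1 y \<and> q2 x = q2 y \<and> q3 x = q3 y"
  by (cases x; cases y) auto

instantiation quat :: ring_1
begin

definition zero_quat where "0 = Quat 0 0 0 0"

definition one_quat where "1 = Quat 1 0 0 0"

definition plus_quat where
  "x + y = Quat (q0 x + q0 y) (q1 x + q1 y) (q2 x + q2 y) (q3 x + q3 y)"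

definition uminus_quat where
  "- x = Quat (- q0 x) (- q1 x) (- q2 x) (- q3 x)"

definition minus_quat where
  "x - y = Quat (q0 x - q0 y) (q1 x - q1 y) (q2 x - q2 y) (q3 x - q3 y)"

definition times_quat where
  "x * y = Quat
    (q0 x * q0 y - q1 x * q1 y - q2 x * q2 y - q3 x * q3 y)
    (q0 x * q1 y + q1 x * q0 y + q2 x * q3 y - q3 x * q2 y)
    (q0 x * q2 y - q1 x * q3 y + q2 x * q0 y + q3 x * q1 y)
    (q0 x * q3 y + q1 x * q2 y - q2 x * q1 y + q3 x * q0 y)"

instance
  by standard
    (simp_all add: zero_quat_def one_quat_def plus_quat_def uminus_quat_def minus_quat_def
      times_quat_def quat_eq_iff algebra_simps)

end

lemma quat_sel_simps [simp]:
  "q0 0 = 0" "q1 0 = 0" "q2 0 = 0" "q3 0 = 0"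
  "q0 1 = 1" "q1 1 = 0" "q2 1 = 0" "q3 1 = 0"
  "q0 (x + y) = q0 x + q0 y" "q1 (x + y) = q1 x + q1 y"
  "q2 (x + y) = q2 x + q2 y" "q3 (x + y) = q3 x + q3 y"
  "q0 (x - y) = q0 x - q0 y" "q1 (x - y) = q1 x - q1 y"
  "q2 (x - y) = q2 x - q2 y" "q3 (x - y) = q3 x - q3 y"
  "q0 (- x) = - q0 x" "q1 (- x) = - q1 x" "q2 (- x) = - q2 x" "q3 (- x) = - q3 x"
  "q0 (x * y) = q0 x * q0 y - q1 x * q1 y - q2 x * q2 y - q3 x * q3 y"
  "q1 (x * y) = q0 x * q1 y + q1 x * q0 y + q2 x * q3 y - q3 x * q2 y"
  "q2 (x * y) = q0 x * q2 y - q1 x * q3 y + q2 x * q0 y + q3 x * q1 y"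
  "q3 (x * y) = q0 x * q3 y + q1 x * q2 y - q2 x * q1 y + q3 x * q0 y"
  by (simp_all add: zero_quat_def one_quat_def plus_quat_def uminus_quat_def minus_quat_def
      times_quat_def)

definition quat_i :: quat where "quat_i = Quat 0 1 0 0"

definition quat_j :: quat where "quat_j = Quat 0 0 1 0"

definition quat_k :: quat where "quat_k = Quat 0 0 0 1"

lemma quat_units:
  "quat_i * quat_i = - 1" "quat_j * quat_j = - 1" "quat_k * quat_k = - 1"
  "quat_i * quat_j = quat_k" "quat_j * quat_k = quat_i" "quat_k * quat_i = quat_j"
  by (simp_all add: quat_i_def quat_j_def quat_k_def quat_eq_iff)

definition quat_cnj :: "quat \<Rightarrow> quat" where
  "quat_cnj x = Quat (q0 x) (- q1 x) (- q2 x) (- q3 x)"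

definition quat_normsq :: "quat \<Rightarrow> real" where
  "quat_normsq x = (q0 x)\<^sup>2 + (q1 x)\<^sup>2 + (q2 x)\<^sup>2 + (q3 x)\<^sup>2"

lemma quat_normsq_eq_0_iff: "quat_normsq x = 0 \<longleftrightarrow> x = 0"
  by (simp add: quat_normsq_def quat_eq_iff add_nonneg_eq_0_iff)

instantiation quat :: inverse
begin

definition inverse_quat :: "quat \<Rightarrow> quat" where
  "inverse x = Quat (q0 x / quat_normsq x) (- q1 x / quat_normsq x)
    (- q2 x / quat_normsq x) (- q3 x / quat_normsq x)"

definition divide_quat :: "quat \<Rightarrow> quat \<Rightarrow> quat" where
  "x div y = x * inverse y" for x y :: quat

instance ..

end

instance quat :: division_ring
proof
  fix x y :: quat
  show "x / y = x * inverse y"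
    by (simp add: divide_quat_def)
  show "inverse (0 :: quat) = 0"
    by (simp add: inverse_quat_def quat_eq_iff)
  assume "x \<noteq> 0"
  then have n: "quat_normsq x \<noteq> 0"
    by (simp add: quat_normsq_eq_0_iff)
  have e: "q0 x * q0 x / quat_normsq x + q1 x * q1 x / quat_normsq x
      + q2 x * q2 x / quat_normsq x + q3 x * q3 x / quat_normsq x = 1"
    unfolding add_divide_distrib [symmetric]
    using n by (simp add: quat_normsq_def power2_eq_square)
  show "inverse x * x = 1" "x * inverse x = 1"
    using e by (simp_all add: inverse_quat_def quat_eq_iff algebra_simps)
qed

definition quat_of_complex :: "complex \<Rightarrow> quat" where
  "quat_of_complex z = Quat (Re z) (Im z) 0 0"

text \<open>The components in \<open>x = x\<^sup>S + j x\<^sup>P\<close>; since \<open>j i = - k\<close>, \<open>x\<^sup>P = x2 - x3 i\<close>.\<close>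

definition simplex_part :: "quat \<Rightarrow> complex" where
  "simplex_part x = Complex (q0 x) (q1 x)"

definition perplex_part :: "quat \<Rightarrow> complex" where
  "perplex_part x = Complex (q2 x) (- q3 x)"

lemma quat_decomposition_iff:
  "x = quat_of_complex a + quat_j * quat_of_complex b \<longleftrightarrow>
     a = simplex_part x \<and> b = perplex_part x"
  by (auto simp: quat_eq_iff quat_of_complex_def quat_j_def simplex_part_def perplex_part_def
      complex_eq_iff)


section \<open>The Study determinant\<close>

definition psi :: "quat mat \<Rightarrow> complex mat" where
  "psi M = four_block_mat
     (map_mat simplex_part M) (map_mat (\<lambda>x. - cnj (perplex_part x)) M)
     (map_mat perplex_part M) (map_mat (\<lambda>x. cnj (simplex_part x)) M)"

text \<open>The \<open>(r, s)\<close> entry of \<open>\<Sum>k. psi (M\<^sub>k) t\<^sup>k\<close>, where the entries of \<open>M\<^sub>k\<close> are the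
  coefficients of \<open>t\<^sup>k\<close> in the entries of \<open>M\<close>.\<close>

definition psi_t :: "quat fps mat \<Rightarrow> complex fps mat" where
  "psi_t M = mat (2 * dim_row M) (2 * dim_col M)
     (\<lambda>(r, s). Abs_fps (\<lambda>k. psi (map_mat (\<lambda>a. fps_nth a k) M) $$ (r, s)))"

definition Sdet_t :: "quat fps mat \<Rightarrow> complex fps" where
  "Sdet_t M = det (psi_t M)"


section \<open>Power series over the quaternions\<close>

definition fps_quat_cnj :: "quat fps \<Rightarrow> quat fps" where
  "fps_quat_cnj f = Abs_fps (\<lambda>n. quat_cnj (fps_nth f n))"

definition fps_quat_of_complex :: "complex fps \<Rightarrow> quat fps" where
  "fps_quat_of_complex f = Abs_fps (\<lambda>n. quat_of_complex (fps_nth f n))"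

text \<open>Unconditional convergence, in the topology of formal power series, of a possibly infinite
  product over a ring that need not be commutative: each coefficient of a finite partial product is
  eventually constant, whatever the order in which its factors are multiplied.\<close>

definition has_fps_prod :: "('b \<Rightarrow> 'a::ring_1 fps) \<Rightarrow> 'b set \<Rightarrow> 'a fps \<Rightarrow> bool" where
  "has_fps_prod f A p \<longleftrightarrow>
     (\<forall>n. \<exists>F. finite F \<and> F \<subseteq> A \<and>
        (\<forall>xs. distinct xs \<and> F \<subseteq> set xs \<and> set xs \<subseteq> A \<longrightarrow>
           fps_nth (prod_list (map f xs)) n = fps_nth p n))"

definition fps_prod :: "('b \<Rightarrow> 'a::ring_1 fps) \<Rightarrow> 'b set \<Rightarrow> 'a fps" where
  "fps_prod f A = (THE p. has_fps_prod f A p)"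

lemma has_fps_prod_unique:
  assumes "has_fps_prod f A p" "has_fps_prod f A q"
  shows "p = q"
proof (rule fps_ext)
  fix n
  obtain F where F: "finite F" "F \<subseteq> A"
    "\<And>xs. distinct xs \<and> F \<subseteq> set xs \<and> set xs \<subseteq> A \<Longrightarrow>
       fps_nth (prod_list (map f xs)) n = fps_nth p n"
    using assms(1) unfolding has_fps_prod_def by metis
  obtain H where H: "finite H" "H \<subseteq> A"
    "\<And>xs. distinct xs \<and> H \<subseteq> set xs \<and> set xs \<subseteq> A \<Longrightarrow>
       fps_nth (prod_list (map f xs)) n = fps_nth q n"
    using assms(2) unfolding has_fps_prod_def by metis
  obtain xs where "set xs = F \<union> H" "distinct xs"
    using finite_distinct_list [of "F \<union> H"] F(1) H(1) by auto
  then show "fps_nth p n = fps_nth q n"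
    using F(2,3) H(2,3) by (metis Un_least Un_upper1 Un_upper2)
qed

lemma fps_prod_eqI: "has_fps_prod f A p \<Longrightarrow> fps_prod f A = p"
  unfolding fps_prod_def using has_fps_prod_unique by blast


section \<open>Lyndon words\<close>

text \<open>Words over the alphabet \<open>{0 < 1 < \<dots> < n - 1}\<close> (letters are numbered from 0, to agree with
  matrix indices) that are strictly smaller than all of their nontrivial rotations.\<close>

definition lyndon_words :: "nat \<Rightarrow> nat list set" where
  "lyndon_words n = {ws. ws \<noteq> [] \<and> set ws \<subseteq> {0..<n} \<and>
     (\<forall>us vs. us \<noteq> [] \<longrightarrow> vs \<noteq> [] \<longrightarrow> ws = us @ vs \<longrightarrow> (ws, vs @ us) \<in> lexord less_than)}"


section \<open>Weighted graphs and the zeta function\<close>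

text \<open>A finite graph without loops or multiple edges is a symmetric loop-free pair digraph
  (\<^locale>\<open>pair_graph\<close>), whose arcs \<open>(u, v)\<close> form \<open>D(G)\<close>: origin \<^const>\<open>fst\<close>, terminus
  \<^const>\<open>snd\<close>, reversal \<^const>\<open>prod.swap\<close>.\<close>

text \<open>Position \<open>k\<close> here is position \<open>k + 1\<close> in the enumeration \<open>e\<^sub>1, \<dots>, e\<^sub>2\<^sub>m\<close>. In particular
  \<open>G\<close> has \<open>2 m\<close> arcs, hence \<open>m\<close> edges.\<close>

definition arc_enumeration :: "'v pair_pre_digraph \<Rightarrow> nat \<Rightarrow> (nat \<Rightarrow> 'v \<times> 'v) \<Rightarrow> bool" where
  "arc_enumeration G m e \<longleftrightarrow>
     bij_betw e {0..<2 * m} (parcs G) \<and> (\<forall>k<m. e (m + k) = prod.swap (e k))"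

definition quaternionic_weight :: "'v pair_pre_digraph \<Rightarrow> ('v \<times> 'v \<Rightarrow> quat) \<Rightarrow> bool" where
  "quaternionic_weight G w \<longleftrightarrow> (\<forall>a. a \<notin> parcs G \<longrightarrow> w a = 0)"

definition path_weight :: "('v \<times> 'v \<Rightarrow> quat) \<Rightarrow> ('v \<times> 'v) list \<Rightarrow> quat" where
  "path_weight w P = prod_list (map w P)"

definition has_backtracking :: "('v \<times> 'v) list \<Rightarrow> bool" where
  "has_backtracking P \<longleftrightarrow> (\<exists>i. Suc i < length P \<and> P ! Suc i = prod.swap (P ! i))"

text \<open>\<^const>\<open>wf_digraph.closed_w\<close> is a nonempty closed walk, that is, a cycle in the sense of
  graph zeta functions: vertices and arcs may repeat.\<close>

definition reduced_cycle :: "'v pair_pre_digraph \<Rightarrow> ('v \<times> 'v) list \<Rightarrow> bool" where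
  "reduced_cycle G C \<longleftrightarrow>
     wf_digraph.closed_w (with_proj G) C \<and> \<not> has_backtracking C \<and> \<not> has_backtracking (C @ C)"

definition lyndon_cycles ::
    "'v pair_pre_digraph \<Rightarrow> nat \<Rightarrow> (nat \<Rightarrow> 'v \<times> 'v) \<Rightarrow> ('v \<times> 'v) list set" where
  "lyndon_cycles G m e = {C. reduced_cycle G C \<and> (\<exists>ws \<in> lyndon_words (2 * m). C = map e ws)}"

definition cycle_series :: "('v \<times> 'v \<Rightarrow> quat) \<Rightarrow> ('v \<times> 'v) list \<Rightarrow> quat fps" where
  "cycle_series w C = 1 - fps_const (path_weight w C) * fps_X ^ length C"

definition zeta_H ::
    "'v pair_pre_digraph \<Rightarrow> nat \<Rightarrow> (nat \<Rightarrow> 'v \<times> 'v) \<Rightarrow> ('v \<times> 'v \<Rightarrow> quat) \<Rightarrow> quat fps" where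
  "zeta_H G m e w =
     fps_prod (\<lambda>C. inverse (cycle_series w C * fps_quat_cnj (cycle_series w C)))
       (lyndon_cycles G m e)"

definition B_mat :: "nat \<Rightarrow> (nat \<Rightarrow> 'v \<times> 'v) \<Rightarrow> ('v \<times> 'v \<Rightarrow> quat) \<Rightarrow> quat mat" where
  "B_mat m e w = mat (2 * m) (2 * m)
     (\<lambda>(r, s). if snd (e r) = fst (e s) then w (e r) else 0)"

definition J_mat :: "nat \<Rightarrow> (nat \<Rightarrow> 'v \<times> 'v) \<Rightarrow> ('v \<times> 'v \<Rightarrow> quat) \<Rightarrow> quat mat" where
  "J_mat m e w = mat (2 * m) (2 * m)
     (\<lambda>(r, s). if e s = prod.swap (e r) then w (e r) else 0)"


section \<open>Convergence of the product defining the zeta function\<close>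

lemma prod_list_cong_mset:
  fixes f :: "'b \<Rightarrow> 'a::monoid_mult"
  assumes "mset xs = mset ys"
    and "\<And>a b. a \<in> set xs \<Longrightarrow> b \<in> set xs \<Longrightarrow> f a * f b = f b * f a"
  shows "prod_list (map f xs) = prod_list (map f ys)"
  using assms
proof (induction xs arbitrary: ys)
  case Nil
  then show ?case by simp
next
  case (Cons x xs)
  have "x \<in> set ys"
    using Cons.prems(1) by (metis list.set_intros(1) mset_eq_setD)
  then obtain us vs where ys: "ys = us @ x # vs"
    by (meson split_list)
  have sub: "set us \<subseteq> set (x # xs)"
    using Cons.prems(1) ys by (metis mset_eq_setD set_append Un_upper1)
  have comm: "f x * prod_list (map f zs) = prod_list (map f zs) * f x"
    if "set zs \<subseteq> set (x # xs)" for zs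
    using that
  proof (induction zs)
    case (Cons z zs)
    have "f x * f z = f z * f x"
      using Cons.prems \<open>\<And>b a. a \<in> set (x # xs) \<Longrightarrow> b \<in> set (x # xs) \<Longrightarrow> f a * f b = f b * f a\<close>
      by auto
    then show ?case
      using Cons by (simp add: mult.assoc) (metis mult.assoc)
  qed simp
  have "prod_list (map f xs) = prod_list (map f (us @ vs))"
    using Cons.prems ys by (intro Cons.IH) auto
  then show ?case
    using comm [OF sub] by (simp add: ys) (metis mult.assoc)
qed

lemma fps_mult_agree:
  fixes f g :: "'a::ring_1 fps"
  assumes "\<And>k. k \<le> n \<Longrightarrow> fps_nth f k = fps_nth f' k" "\<And>k. k \<le> n \<Longrightarrow> fps_nth g k = fps_nth g' k"
    and "k \<le> n"
  shows "fps_nth (f * g) k = fps_nth (f' * g') k"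
  unfolding fps_mult_nth using assms by (intro sum.cong) auto

lemma has_fps_prod_exists:
  fixes f :: "'b \<Rightarrow> 'a::ring_1 fps"
  assumes comm: "\<And>a b. a \<in> A \<Longrightarrow> b \<in> A \<Longrightarrow> f a * f b = f b * f a"
    and fin: "\<And>n. finite {a \<in> A. d a \<le> n}"
    and one: "\<And>a k. a \<in> A \<Longrightarrow> k < d a \<Longrightarrow> fps_nth (f a) k = fps_nth 1 k"
  shows "\<exists>p. has_fps_prod f A p"
proof -
  have "\<exists>ys. set ys = {a \<in> A. d a \<le> n} \<and> distinct ys" for n :: nat
    using finite_distinct_list [OF fin] by blast
  then obtain L where L: "\<And>n. set (L n) = {a \<in> A. d a \<le> n}" "\<And>n. distinct (L n)"
    by metis
  define p where "p = Abs_fps (\<lambda>n. fps_nth (prod_list (map f (L n))) n)"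
  have filt: "fps_nth (prod_list (map f xs)) k
      = fps_nth (prod_list (map f (filter (\<lambda>a. d a \<le> n) xs))) k"
    if "set xs \<subseteq> A" "k \<le> n" for xs n k
    using that
  proof (induction xs arbitrary: k)
    case (Cons x xs)
    show ?case
    proof (cases "d x \<le> n")
      case True
      then show ?thesis
        using Cons.IH Cons.prems
        by (simp add: fps_mult_agree [of n "f x" "f x" "prod_list (map f xs)"
              "prod_list (map f (filter (\<lambda>a. d a \<le> n) xs))"])
    next
      case False
      then have "fps_nth (f x * prod_list (map f xs)) k
          = fps_nth (1 * prod_list (map f (filter (\<lambda>a. d a \<le> n) xs))) k"
        using Cons.IH Cons.prems one [of x] by (intro fps_mult_agree [of n]) auto
      then show ?thesis
        using False by simp
    qed
  qed simp
  have "has_fps_prod f A p"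
    unfolding has_fps_prod_def
  proof (intro allI exI conjI impI)
    fix n xs
    assume xs: "distinct xs \<and> {a \<in> A. d a \<le> n} \<subseteq> set xs \<and> set xs \<subseteq> A"
    then have "mset (filter (\<lambda>a. d a \<le> n) xs) = mset (L n)"
      using L by (subst set_eq_iff_mset_eq_distinct [symmetric]) auto
    then have "prod_list (map f (filter (\<lambda>a. d a \<le> n) xs)) = prod_list (map f (L n))"
      using comm xs by (intro prod_list_cong_mset) auto
    then show "fps_nth (prod_list (map f xs)) n = fps_nth p n"
      using filt [of xs n n] xs by (simp add: p_def)
  qed (use fin in auto)
  then show ?thesis ..
qed

lemma real_quat_fps_central:
  fixes f g :: "quat fps"
  assumes "\<And>n. q1 (fps_nth f n) = 0 \<and> q2 (fps_nth f n) = 0 \<and> q3 (fps_nth f n) = 0"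
  shows "f * g = g * f"
proof (rule fps_ext)
  fix n
  have c: "fps_nth f k * x = x * fps_nth f k" for k x
    using assms [of k] by (simp add: quat_eq_iff)
  show "fps_nth (f * g) n = fps_nth (g * f) n"
    unfolding fps_mult_nth c
    by (rule sum.reindex_bij_witness [of _ "\<lambda>i. n - i" "\<lambda>i. n - i"]) auto
qed

lemma cycle_factor_eq:
  fixes x :: quat
  assumes "0 < l"
  defines "s \<equiv> 1 - fps_const x * fps_X ^ l"
  shows "s * fps_quat_cnj s
    = 1 - fps_const (x + quat_cnj x) * fps_X ^ l + fps_const (x * quat_cnj x) * fps_X ^ (2 * l)"
proof -
  have "fps_quat_cnj s = 1 - fps_const (quat_cnj x) * fps_X ^ l"
    using assms(1)
    by (intro fps_ext) (auto simp: s_def fps_quat_cnj_def quat_cnj_def quat_eq_iff)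
  then have "s * fps_quat_cnj s
      = (1 - fps_const x * fps_X ^ l) * (1 - fps_const (quat_cnj x) * fps_X ^ l)"
    by (simp only: s_def)
  moreover have "fps_const x * fps_X ^ l * (fps_const (quat_cnj x) * fps_X ^ l)
      = fps_const (x * quat_cnj x) * fps_X ^ (2 * l)"
    by (metis (no_types, lifting) fps_const_mult fps_mult_fps_X_power_commute mult.assoc mult_2
        power_add)
  moreover have "fps_const (x + quat_cnj x) * fps_X ^ l
      = fps_const x * fps_X ^ l + fps_const (quat_cnj x) * fps_X ^ l"
    unfolding fps_const_add [symmetric] by (rule distrib_right)
  moreover have "(1 - p) * (1 - q) = 1 - (p + q) + p * q" for p q :: "quat fps"
    by (simp add: algebra_simps)
  ultimately show ?thesis
    by (simp only:)
qed

lemma zeta_H_converges: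
  "has_fps_prod (\<lambda>C. inverse (cycle_series w C * fps_quat_cnj (cycle_series w C)))
    (lyndon_cycles G m e) (zeta_H G m e w)"
proof -
  let ?g = "\<lambda>C. cycle_series w C * fps_quat_cnj (cycle_series w C)"
  have len: "0 < length C" if "C \<in> lyndon_cycles G m e" for C
    using that by (auto simp: lyndon_cycles_def lyndon_words_def)
  have g: "?g C = 1 - fps_const (path_weight w C + quat_cnj (path_weight w C)) * fps_X ^ length C
      + fps_const (path_weight w C * quat_cnj (path_weight w C)) * fps_X ^ (2 * length C)"
    if "C \<in> lyndon_cycles G m e" for C
    unfolding cycle_series_def using len [OF that] by (rule cycle_factor_eq)
  have g_nth: "fps_nth (?g C) k = fps_nth 1 k"
    if "C \<in> lyndon_cycles G m e" "k < length C" for C k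
    using that by (simp add: g)
  have g0: "fps_nth (?g C) 0 = 1" if "C \<in> lyndon_cycles G m e" for C
    using g_nth [OF that len [OF that]] by simp
  have central: "?g C * h = h * ?g C" if "C \<in> lyndon_cycles G m e" for C h
    by (rule real_quat_fps_central) (simp add: g [OF that] quat_cnj_def)
  have inv: "inverse (?g C) * ?g C = 1" "?g C * inverse (?g C) = 1"
    if "C \<in> lyndon_cycles G m e" for C
    using g0 [OF that] inverse_mult_eq_1 [of "?g C"] central [OF that] by auto
  have comm: "inverse (?g C) * h = h * inverse (?g C)" if "C \<in> lyndon_cycles G m e" for C h
    by (metis (no_types, lifting) central [OF that] inv [OF that] mult.assoc mult.left_neutral
        mult.right_neutral)
  have fin: "finite {C \<in> lyndon_cycles G m e. length C \<le> n}" for n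
  proof -
    have "{C \<in> lyndon_cycles G m e. length C \<le> n}
        \<subseteq> map e ` {ws. set ws \<subseteq> {0..<2 * m} \<and> length ws \<le> n}"
      by (auto simp: lyndon_cycles_def lyndon_words_def)
    then show ?thesis
      by (rule finite_subset)
        (rule finite_imageI [OF finite_lists_length_le [OF finite_atLeastLessThan]])
  qed
  have one: "fps_nth (inverse (?g C)) k = fps_nth 1 k"
    if "C \<in> lyndon_cycles G m e" "k < length C" for C k
  proof -
    have "fps_nth (inverse (?g C) * ?g C) k = fps_nth (inverse (?g C) * 1) k"
      by (rule fps_mult_agree [of k]) (use that g_nth in auto)
    then show ?thesis
      using inv [OF that(1)] by simp
  qed
  have "\<exists>p. has_fps_prod (\<lambda>C. inverse (?g C)) (lyndon_cycles G m e) p"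
    by (rule has_fps_prod_exists [where d = length], erule comm, rule fin, erule (1) one)
  then obtain p where p: "has_fps_prod (\<lambda>C. inverse (?g C)) (lyndon_cycles G m e) p" ..
  then show ?thesis
    unfolding zeta_H_def by (simp only: fps_prod_eqI [OF p])
qed

end

theory Submission
  imports Defs "HOL-Library.List_Lexorder" "Jordan_Normal_Form.Schur_Decomposition"
begin

text \<open>A formal power series with constant coefficient \<open>1\<close> over the complex numbers is determined by
  its logarithmic derivative, so it suffices to compare those of the two sides. For the determinant of
  \<open>1 - t A\<close>, where \<open>A\<close> is the complex matrix of \<open>M = B\<^sub>w - J\<^sub>w\<close>, it is given by the traces of the
  \<open>A\<^sup>k\<close>, that is, by the sums of \<open>2 Re\<close> of the cyclic weights \<open>M\<^bsub>i\<^sub>1 i\<^sub>2\<^esub> \<cdots> M\<^bsub>i\<^sub>k i\<^sub>1\<^esub>\<close> over all words of length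
  \<open>k\<close>. These real parts are invariant under rotation, and every nonempty word arises in a unique
  way by rotating a power of a Lyndon word \<open>u\<close> by fewer than \<open>|u|\<close> steps; grouping the words accordingly gives the
  power sums of the norm polynomials \<open>1 - 2 Re(x) t\<^sup>l + |x|\<^sup>2 t\<^sup>2\<^sup>l\<close> of the Lyndon words. A word whose cyclic
  weight is not zero is a reduced cycle.\<close>

section \<open>Words as rotations of Lyndon powers\<close>

lemma rotate_comp_length: "rotate (length xs - i) (rotate i xs) = xs" if "i \<le> length xs"
  using that by (simp add: rotate_rotate)

text \<open>One rotation step moves the first letter of (x ys)^n to its end, and (x ys)^n x = x (ys
  x)^n regroups the letters around it.\<close>

lemma rotate_concat_replicate:
  "rotate i (concat (replicate n xs)) = concat (replicate n (rotate i xs))"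
proof (induction i)
  case (Suc i)
  have *: "concat (replicate n (x # ys)) @ [x] = x # concat (replicate n (ys @ [x]))" for x and ys :: "'a list"
    by (induction n) auto
  have "rotate1 (concat (replicate n ys)) = concat (replicate n (rotate1 ys))" for ys :: "'a list"
  proof (cases "n = 0 \<or> ys = []")
    case False
    then obtain x zs k where "ys = x # zs" "n = Suc k"
      by (metis list.exhaust old.nat.exhaust)
    then show ?thesis
      using *[of x zs] by simp
  qed auto
  then show ?case
    using Suc by simp
qed simp

lemma length_concat_replicate: "length (concat (replicate n xs)) = n * length xs"
  by (induction n) auto

lemma set_concat_replicate: "n > 0 \<Longrightarrow> set (concat (replicate n xs)) = set xs"
  by (induction n) (auto simp: gr0_conv_Suc)

lemma concat_replicate_mult:
  "concat (replicate m (concat (replicate n xs))) = concat (replicate (m * n) xs)"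
  by (induction m) (auto simp: replicate_add)

text \<open>Since the lengths agree, \<open>xs\<close> is no proper prefix of \<open>ys\<close>, so
  the first blocks already decide the comparison.\<close>

lemma concat_replicate_less:
  fixes xs ys :: "'a::linorder list"
  assumes "length xs = length ys" "xs < ys" "n > 0"
  shows "concat (replicate n xs) < concat (replicate n ys)"
  using assms by (cases n) (auto simp: list_less_def intro: lexord_sufI)

section \<open>Lyndon words: minimality, primitivity and unique decomposition\<close>

definition words :: "nat \<Rightarrow> nat \<Rightarrow> nat list set" where
  "words N k = {ws. set ws \<subseteq> {0..<N} \<and> length ws = k}"

text \<open>Splitting \<open>u = us @ vs\<close> amounts to rotating by \<open>length us\<close>;
  this form gives access to \<open>rotate\<close> and to the linear order on lists.\<close>

lemma lyndon_words_iff: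
  "u \<in> lyndon_words N \<longleftrightarrow>
     u \<noteq> [] \<and> set u \<subseteq> {0..<N} \<and> (\<forall>i. 0 < i \<longrightarrow> i < length u \<longrightarrow> u < rotate i u)"
proof -
  have lt: "us < vs \<longleftrightarrow> (us, vs) \<in> lexord less_than" for us vs :: "nat list"
    by (simp add: list_less_def less_than_iff[symmetric] del: less_than_iff)
  have "(\<forall>us vs. us \<noteq> [] \<longrightarrow> vs \<noteq> [] \<longrightarrow> u = us @ vs \<longrightarrow> u < vs @ us) \<longleftrightarrow>
     (\<forall>i. 0 < i \<longrightarrow> i < length u \<longrightarrow> u < rotate i u)" (is "?L \<longleftrightarrow> ?R")
  proof
    assume L: ?L
    show ?R
    proof (intro allI impI)
      fix i assume "0 < i" "i < length u"
      then show "u < rotate i u"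
        using L[rule_format, of "take i u" "drop i u"] by (simp add: rotate_drop_take) fastforce
    qed
  next
    assume R: ?R
    show ?L
    proof (intro allI impI)
      fix us vs assume "us \<noteq> []" "vs \<noteq> []" "u = us @ vs"
      then show "u < vs @ us"
        using R[rule_format, of "length us"] by (simp add: rotate_append)
    qed
  qed
  then show ?thesis
    by (simp add: lyndon_words_def lt)
qed

text \<open>Primitivity, the source of uniqueness for both the base and the rotation index
  below.\<close>

lemma lyndon_rotate_neq:
  assumes "u \<in> lyndon_words N" "0 < i" "i < length u"
  shows "rotate i u \<noteq> u"
  using assms unfolding lyndon_words_iff by (metis less_irrefl)

text \<open>A rotation of the power passes to its base, where it is trivial or strictly increases
  the word. The power is thus the least representative of its rotation class.\<close>

lemma lyndon_power_le_rotate: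
  assumes "u \<in> lyndon_words N"
  shows "concat (replicate n u) \<le> rotate i (concat (replicate n u))"
proof (cases "n = 0 \<or> i mod length u = 0")
  case True
  then show ?thesis
    by (auto simp: rotate_concat_replicate)
next
  case False
  have "u < rotate i u"
    using assms False by (subst rotate_conv_mod) (simp add: lyndon_words_iff)
  then show ?thesis
    using False by (simp add: rotate_concat_replicate concat_replicate_less less_imp_le)
qed

text \<open>Rotation by \<open>length u\<close> fixes the common power and hence its base
  \<open>v\<close>; a shorter \<open>u\<close> would contradict the primitivity of
  \<open>v\<close>.\<close>

lemma lyndon_power_eq_imp_length_le:
  assumes u: "u \<in> lyndon_words N" and v: "v \<in> lyndon_words N"
    and eq: "concat (replicate n u) = concat (replicate m v)" and "m > 0"
  shows "length v \<le> length u"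
proof (rule ccontr)
  assume "\<not> ?thesis"
  moreover have "0 < length u"
    using u by (simp add: lyndon_words_iff)
  moreover have "rotate (length u) (concat (replicate n u)) = concat (replicate n u)"
    by (simp add: rotate_concat_replicate)
  then have "concat (replicate m (rotate (length u) v)) = concat (replicate m v)"
    unfolding eq rotate_concat_replicate .
  then have "rotate (length u) v = v"
    using \<open>m > 0\<close> by (auto simp: gr0_conv_Suc)
  ultimately show False
    using lyndon_rotate_neq[OF v, of "length u"] by simp
qed

text \<open>Both powers are least in the same rotation class, so they coincide; comparing their
  periods both ways gives \<open>u = v\<close>, and primitivity then separates the indices.\<close>

lemma lyndon_rotation_inject:
  assumes u: "u \<in> lyndon_words N" and v: "v \<in> lyndon_words N" and k: "k > 0"
    and du: "length u dvd k" and dv: "length v dvd k" and i: "i < length u" and j: "j < length v"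
    and eq: "rotate i (concat (replicate (k div length u) u)) =
      rotate j (concat (replicate (k div length v) v))"
  shows "u = v \<and> i = j"
proof -
  let ?x = "concat (replicate (k div length u) u)" and ?y = "concat (replicate (k div length v) v)"
  have pos: "k div length u > 0" "k div length v > 0"
    using k du dv by (auto simp: dvd_div_eq_0_iff)
  have len: "length ?x = k" "length ?y = k"
    using du dv by (simp_all only: length_concat_replicate dvd_div_mult_self)
  have ik: "i \<le> k" "j \<le> k"
    using i j k du dv dvd_imp_le[of _ k] by fastforce+
  \<comment> \<open>Undoing a rotation by the complementary amount makes each power a rotation of
    the other, so minimality yields both inequalities.\<close>
  have "?x = rotate (k - i + j) ?y" "?y = rotate (k - j + i) ?x"
    using rotate_comp_length[of i ?x] rotate_comp_length[of j ?y] eq ik unfolding len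
    by (metis rotate_rotate)+
  then have xy: "?x = ?y"
    using lyndon_power_le_rotate[OF u] lyndon_power_le_rotate[OF v] by (metis antisym)
  have l: "length u = length v"
    using lyndon_power_eq_imp_length_le[OF u v xy] lyndon_power_eq_imp_length_le[OF v u xy[symmetric]]
      pos by simp
  have uv: "u = v"
    using xy pos l by (auto simp: gr0_conv_Suc)
  have False if "p < q" "q < length v" "rotate p v = rotate q v" for p q
  proof -
    have "rotate (length v - p) (rotate q v) = v"
      using that rotate_comp_length[of p v] by simp
    moreover have "length v - p + q = (q - p) + length v"
      using that by simp
    ultimately have "rotate (q - p + length v) v = v"
      by (simp only: rotate_rotate)
    then have "rotate (q - p) v = v"
      by (metis mod_add_self2 rotate_conv_mod)
    then show False
      using lyndon_rotate_neq[OF v, of "q - p"] that by simp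
  qed
  moreover have "rotate i v = rotate j v"
    using eq pos by (auto simp: uv rotate_concat_replicate gr0_conv_Suc)
  ultimately show ?thesis
    using i j uv by (metis linorder_neqE_nat)
qed

text \<open>Induction on the length: a word fixed by a proper rotation is a power of a shorter word;
  otherwise its least rotation is strictly least, hence Lyndon.\<close>

lemma lyndon_decomposition:
  assumes "xs \<noteq> []" "set xs \<subseteq> {0..<N}"
  shows "\<exists>u\<in>lyndon_words N. \<exists>i<length u. \<exists>n>0. xs = rotate i (concat (replicate n u))"
  using assms
proof (induction "length xs" arbitrary: xs rule: less_induct)
  case less
  show ?case
  proof (cases "\<exists>i. 0 < i \<and> i < length xs \<and> rotate i xs = xs")
    case True
    then obtain i where i: "0 < i" "i < length xs" "rotate i xs = xs"
      by blast
    define a b where "a = take i xs" and "b = drop i xs"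
    have ab: "xs = a @ b" "a @ b = b @ a" "a \<noteq> []" "b \<noteq> []"
      using i by (auto simp: a_def b_def rotate_drop_take)
    \<comment> \<open>Commuting words are powers of a common word.\<close>
    then obtain m n z where z: "concat (replicate m z) = a" "concat (replicate n z) = b"
      using comm_append_are_replicate[of a b] by blast
    have mn: "m > 0" "n > 0" "z \<noteq> []"
      using ab z by (auto intro!: Nat.gr0I)
    have xs: "xs = concat (replicate (m + n) z)"
      using ab z by (simp add: replicate_add)
    have "length z < length xs"
      unfolding xs length_concat_replicate using mn by (cases m; cases n) auto
    moreover have "set z \<subseteq> {0..<N}"
      using less.prems xs mn set_concat_replicate[of "m + n" z] by simp
    ultimately obtain u i p where "u \<in> lyndon_words N" "i < length u" "p > 0"
      "z = rotate i (concat (replicate p u))"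
      using less.hyps[of z] mn(3) by blast
    moreover from this have "xs = rotate i (concat (replicate ((m + n) * p) u))"
      by (simp add: xs rotate_concat_replicate concat_replicate_mult)
    moreover have "(m + n) * p > 0"
      using mn \<open>p > 0\<close> by simp
    ultimately show ?thesis
      by blast
  next
    case False
    define S where "S = (\<lambda>i. rotate i xs) ` {..<length xs}"
    have S: "finite S" "S \<noteq> {}"
      using less.prems by (auto simp: S_def)
    obtain i where i: "i < length xs" "Min S = rotate i xs"
      using Min_in[OF S] by (auto simp: S_def)
    define u where "u = rotate i xs"
    have inS: "rotate j u \<in> S" for j
      unfolding u_def rotate_rotate
      by (subst rotate_conv_mod)
        (use less.prems in \<open>auto simp: S_def intro!: imageI mod_less_divisor\<close>)
    have "u < rotate j u" if "0 < j" "j < length u" for j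
    proof -
      have "u \<le> rotate j u"
        using Min_le[OF S(1) inS[of j]] by (simp add: i u_def)
      moreover have "u \<noteq> rotate j u"
      proof
        \<comment> \<open>Rotations commute, so one that fixes \<open>u\<close> also fixes
          \<open>xs\<close>, which this case excludes.\<close>
        assume "u = rotate j u"
        then have "rotate (length xs - i) (rotate i xs) = rotate (length xs - i) (rotate j (rotate i xs))"
          by (simp add: u_def)
        also have "\<dots> = rotate j (rotate (length xs - i) (rotate i xs))"
          by (simp only: rotate_rotate ac_simps)
        finally show False
          using False that i unfolding u_def
          by (metis length_rotate less_imp_le rotate_comp_length)
      qed
      ultimately show ?thesis
        by simp
    qed
    then have "u \<in> lyndon_words N"
      using less.prems by (auto simp: lyndon_words_iff u_def)
    \<comment> \<open>For \<open>i = 0\<close> the inverse rotation has index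
      \<open>length xs\<close>, just out of range; hence the reduction modulo the length.\<close>
    moreover have "xs = rotate ((length xs - i) mod length u) (concat (replicate 1 u))"
      using i by (simp add: rotate_comp_length u_def flip: rotate_conv_mod)
        (metis length_rotate less_imp_le_nat rotate_comp_length rotate_conv_mod)
    moreover have "(length xs - i) mod length u < length u"
      using less.prems(1) by (intro mod_less_divisor) (simp add: u_def)
    moreover have "(0::nat) < 1"
      by simp
    ultimately show ?thesis
      by blast
  qed
qed

text \<open>Rotating each Lyndon power of length \<open>k\<close> by fewer than
  \<open>length u\<close> steps enumerates the words of length \<open>k\<close> without repetition;
  invariance of \<open>f\<close> turns each group into the factor \<open>length u\<close>.\<close>

lemma sum_words_eq_sum_lyndon_words:
  fixes f :: "nat list \<Rightarrow> 'a::semiring_1"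
  assumes inv: "\<And>xs. f (rotate1 xs) = f xs" and "k > 0"
  shows "(\<Sum>ws\<in>words N k. f ws) = (\<Sum>u\<in>{u\<in>lyndon_words N. length u dvd k}.
    of_nat (length u) * f (concat (replicate (k div length u) u)))"
proof -
  let ?A = "{u\<in>lyndon_words N. length u dvd k}"
  let ?g = "\<lambda>(u, i). rotate i (concat (replicate (k div length u) u))"
  have rot: "f (rotate i xs) = f xs" for i xs
    by (induction i) (auto simp: inv)
  have finA: "finite ?A"
  proof (rule finite_subset)
    show "?A \<subseteq> {xs. set xs \<subseteq> {0..<N} \<and> length xs \<le> k}"
      using \<open>k > 0\<close> by (auto simp: lyndon_words_iff dest: dvd_imp_le)
  qed (rule finite_lists_length_le, simp)
  let ?S = "SIGMA u:?A. {..<length u}"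
  have "inj_on ?g ?S"
    unfolding inj_on_def using lyndon_rotation_inject \<open>k > 0\<close> by fastforce
  moreover have "?g p \<in> words N k" if p_mem: "p \<in> ?S" for p
  proof -
    obtain u i where p: "p = (u, i)" and u: "u \<in> lyndon_words N" "length u dvd k"
      using p_mem by auto
    then have "k div length u > 0"
      using \<open>k > 0\<close> by (auto simp: dvd_div_eq_0_iff)
    then show ?thesis
      using u by (simp only: p words_def mem_Collect_eq prod.case set_rotate set_concat_replicate
          length_rotate length_concat_replicate dvd_div_mult_self lyndon_words_iff simp_thms)
  qed
  moreover have "xs \<in> ?g ` ?S" if xs: "xs \<in> words N k" for xs
  proof -
    have "xs \<noteq> []" "set xs \<subseteq> {0..<N}"
      using xs \<open>k > 0\<close> by (auto simp: words_def)
    then obtain u i n where u: "u \<in> lyndon_words N" "i < length u" "xs = rotate i (concat (replicate n u))"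
      using lyndon_decomposition by meson
    then have k: "k = n * length u"
      using xs by (simp only: words_def mem_Collect_eq length_rotate length_concat_replicate)
    then have "xs = ?g (u, i)" "(u, i) \<in> ?S"
      using u by auto
    then show ?thesis
      by blast
  qed
  ultimately have "bij_betw ?g ?S (words N k)"
    unfolding bij_betw_def by blast
  then have "(\<Sum>ws\<in>words N k. f ws) = (\<Sum>p\<in>?S. f (?g p))"
    by (rule sum.reindex_bij_betw[symmetric])
  also have "\<dots> = (\<Sum>u\<in>?A. \<Sum>i<length u. f (rotate i (concat (replicate (k div length u) u))))"
    using finA by (subst sum.Sigma) (auto simp: case_prod_beta intro!: sum.cong)
  also have "\<dots> = (\<Sum>u\<in>?A. of_nat (length u) * f (concat (replicate (k div length u) u)))"
    by (simp add: rot)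
  finally show ?thesis .
qed

section \<open>Logarithmic derivatives and traces\<close>

text \<open>\<open>P\<close> is \<open>- t F' / F\<close>: for \<open>F = \<Prod>(1 - a t)\<close> its coefficients are the power sums of the \<open>a\<close>.\<close>

definition log_deriv :: "'a::comm_ring_1 fps \<Rightarrow> 'a fps \<Rightarrow> bool" where
  "log_deriv F P \<longleftrightarrow> fps_nth F 0 = 1 \<and> fps_nth P 0 = 0 \<and> fps_X * fps_deriv F = - (P * F)"

lemma log_deriv_1: "log_deriv 1 0"
  by (simp add: log_deriv_def)

lemma log_deriv_mult:
  assumes "log_deriv F P" "log_deriv G Q"
  shows "log_deriv (F * G) (P + Q)"
proof -
  have "fps_X * fps_deriv (F * G) = (fps_X * fps_deriv F) * G + F * (fps_X * fps_deriv G)"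
    by (simp add: algebra_simps)
  also have "\<dots> = - ((P + Q) * (F * G))"
    using assms by (simp add: log_deriv_def algebra_simps)
  finally show ?thesis
    using assms by (simp add: log_deriv_def)
qed

lemma log_deriv_prod:
  "finite A \<Longrightarrow> (\<And>a. a \<in> A \<Longrightarrow> log_deriv (F a) (P a)) \<Longrightarrow> log_deriv (prod F A) (sum P A)"
  by (induction A rule: finite_induct) (auto intro: log_deriv_1 log_deriv_mult)

text \<open>Coefficient k of the defining equation expresses k F_k through the coefficients of
  \<open>P\<close> and, as P_0 = 0, only lower ones of \<open>F\<close>; characteristic 0 permits
  division by k. The bound \<open>n\<close> makes finite partial products comparable.\<close>

lemma log_deriv_determines:
  fixes F G :: "'a::field_char_0 fps"
  assumes F: "log_deriv F P" and G: "log_deriv G Q"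
    and eq: "\<And>k. 0 < k \<Longrightarrow> k \<le> n \<Longrightarrow> fps_nth P k = fps_nth Q k"
  shows "k \<le> n \<Longrightarrow> fps_nth F k = fps_nth G k"
proof (induction k rule: less_induct)
  case (less k)
  have coeff: "of_nat k * fps_nth H k = - (\<Sum>i=0..k. fps_nth R i * fps_nth H (k - i))"
    if "log_deriv H R" for H R :: "'a fps"
  proof -
    have "of_nat k * fps_nth H k = fps_nth (fps_X * fps_deriv H) k"
      by (cases k) simp_all
    also have "\<dots> = fps_nth (- (R * H)) k"
      using that by (simp add: log_deriv_def)
    finally show ?thesis
      by (simp add: fps_mult_nth)
  qed
  show ?case
  proof (cases "k = 0")
    case True
    then show ?thesis
      using F G by (simp add: log_deriv_def)
  next
    case False
    have "fps_nth P i * fps_nth F (k - i) = fps_nth Q i * fps_nth G (k - i)" if "i \<le> k" for i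
      using that less.IH[of "k - i"] less.prems eq[of i] False F G
      by (cases "i = 0") (simp_all add: log_deriv_def)
    then have "of_nat k * fps_nth F k = of_nat k * fps_nth G k"
      unfolding coeff[OF F] coeff[OF G] by (intro arg_cong[of _ _ uminus] sum.cong) simp_all
    then show ?thesis
      using False by simp
  qed
qed

text \<open>For p(q) = a^q this is -t times the logarithmic derivative of 1 - a t^l. A general
  \<open>p\<close> also admits sums of powers and traces.\<close>

definition power_sum_fps :: "nat \<Rightarrow> (nat \<Rightarrow> 'a::comm_ring_1) \<Rightarrow> 'a fps" where
  "power_sum_fps l p = Abs_fps (\<lambda>k. if 0 < k \<and> l dvd k then of_nat l * p (k div l) else 0)"

lemma power_sum_fps_add: "power_sum_fps l p + power_sum_fps l q = power_sum_fps l (\<lambda>k. p k + q k)"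
  by (rule fps_ext) (simp add: power_sum_fps_def algebra_simps)

text \<open>Multiplication by 1 - a t^l telescopes the geometric series and leaves only l a
  t^l.\<close>

lemma log_deriv_linear:
  fixes a :: "'a::comm_ring_1"
  assumes "l > 0"
  shows "log_deriv (1 - fps_const a * fps_X ^ l) (power_sum_fps l (\<lambda>k. a ^ k))"
proof -
  have "fps_nth (fps_X * fps_deriv (1 - fps_const a * fps_X ^ l)) k =
    fps_nth (- (power_sum_fps l (\<lambda>k. a ^ k) * (1 - fps_const a * fps_X ^ l))) k" for k
  proof -
    have "fps_nth (fps_X * fps_deriv (1 - fps_const a * fps_X ^ l)) k =
        (if k = l then - of_nat l * a else 0)"
      using assms by (cases k) (auto simp: fps_X_power_nth algebra_simps)
    moreover have "fps_nth (power_sum_fps l (\<lambda>k. a ^ k) * (1 - fps_const a * fps_X ^ l)) k =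
        fps_nth (power_sum_fps l (\<lambda>k. a ^ k)) k -
        a * (if k < l then 0 else fps_nth (power_sum_fps l (\<lambda>k. a ^ k)) (k - l))"
      by (simp only: right_diff_distrib fps_sub_nth mult.right_neutral mult.left_commute[of _ "fps_const a"]
          fps_mult_left_const_nth fps_X_power_mult_right_nth)
    moreover have "\<dots> = (if k = l then of_nat l * a else 0)"
    proof (cases "l dvd k \<and> k > l")
      case True
      then obtain q where q: "k = l * q" by blast
      with True obtain r where r: "q = Suc r" "r > 0"
        by (cases q; cases "q - 1") auto
      then show ?thesis
        using assms q by (simp add: power_sum_fps_def algebra_simps)
    next
      case False
      then show ?thesis
        using assms by (auto simp: power_sum_fps_def dvd_minus_self dvd_imp_le)
    qed
    ultimately show ?thesis
      by simp
  qed
  then show ?thesis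
    using assms by (simp add: log_deriv_def fps_eq_iff power_sum_fps_def)
qed

text \<open>Multiplying \<open>F\<close> and \<open>G\<close> by the common factor
  \<open>inverse F * inverse G\<close> exchanges them for each other's inverses and preserves
  agreement up to \<open>n\<close>.\<close>

lemma fps_inverse_agree:
  fixes F G :: "'a::field fps"
  assumes "fps_nth F 0 \<noteq> 0" "\<And>k. k \<le> n \<Longrightarrow> fps_nth F k = fps_nth G k"
  shows "fps_nth (inverse F) n = fps_nth (inverse G) n"
proof -
  have G0: "fps_nth G 0 \<noteq> 0"
    using assms by force
  have "fps_nth (inverse F * inverse G * F) n = fps_nth (inverse F * inverse G * G) n"
    by (rule fps_mult_agree[of n]) (use assms in auto)
  moreover have "inverse F * inverse G * F = inverse G" "inverse F * inverse G * G = inverse F"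
    using inverse_mult_eq_1[OF assms(1)] inverse_mult_eq_1[OF G0]
    by (metis mult.assoc mult.commute mult.right_neutral)+
  ultimately show ?thesis
    by simp
qed

section \<open>Traces of powers and the determinant of 1 - t A\<close>

interpretation fps_const_hom: comm_ring_hom "fps_const :: 'a::comm_ring_1 \<Rightarrow> 'a fps"
  by standard (simp_all flip: fps_const_add fps_const_mult)

definition trace_mat :: "'a::comm_monoid_add mat \<Rightarrow> 'a" where
  "trace_mat A = (\<Sum>i<dim_row A. A $$ (i, i))"

lemma trace_mat_mult_commute:
  fixes A B :: "'a::comm_semiring_0 mat"
  assumes "A \<in> carrier_mat n m" "B \<in> carrier_mat m n"
  shows "trace_mat (A * B) = trace_mat (B * A)"
proof -
  have "trace_mat (A * B) = (\<Sum>i<n. \<Sum>j<m. A $$ (i, j) * B $$ (j, i))"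
    using assms by (auto simp: trace_mat_def scalar_prod_def atLeast0LessThan intro!: sum.cong)
  also have "\<dots> = (\<Sum>j<m. \<Sum>i<n. B $$ (j, i) * A $$ (i, j))"
    by (subst sum.swap) (simp add: mult.commute)
  also have "\<dots> = trace_mat (B * A)"
    using assms by (auto simp: trace_mat_def scalar_prod_def atLeast0LessThan intro!: sum.cong)
  finally show ?thesis .
qed

lemma upper_triangular_pow:
  fixes U :: "'a::semiring_1 mat"
  assumes U: "U \<in> carrier_mat n n" "upper_triangular U"
  shows "upper_triangular (U ^\<^sub>m k) \<and> (\<forall>i<n. (U ^\<^sub>m k) $$ (i, i) = (U $$ (i, i)) ^ k)"
proof (induction k)
  case 0
  then show ?case using U by auto
next
  case (Suc k)
  have car: "U ^\<^sub>m k \<in> carrier_mat n n"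
    using U by simp
  have entry: "(U ^\<^sub>m Suc k) $$ (i, j) = (\<Sum>l\<in>{0..<n}. (U ^\<^sub>m k) $$ (i, l) * U $$ (l, j))"
    if "i < n" "j < n" for i j
    using that U car by (simp add: scalar_prod_def)
  have low: "(U ^\<^sub>m k) $$ (i, l) = 0" if "l < i" "i < n" for i l
    using Suc that car upper_triangularD by blast
  have lowU: "U $$ (i, l) = 0" if "l < i" "i < n" for i l
    using U that upper_triangularD by blast
  have "(U ^\<^sub>m Suc k) $$ (i, j) = 0" if "j < i" "i < n" for i j
  proof -
    have "(U ^\<^sub>m k) $$ (i, l) * U $$ (l, j) = 0" if "l < n" for l
      using low[of l i] lowU[of j l] that \<open>j < i\<close> \<open>i < n\<close> by (cases "l < i") auto
    then show ?thesis
      by (subst entry) (use that in auto)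
  qed
  moreover have "(U ^\<^sub>m Suc k) $$ (i, i) = (U $$ (i, i)) ^ Suc k" if "i < n" for i
  proof -
    \<comment> \<open>For \<open>l < i\<close> the left factor lies below the diagonal, for
      \<open>l > i\<close> the right one does.\<close>
    have "(U ^\<^sub>m k) $$ (i, l) * U $$ (l, i) = 0" if "l < n" "l \<noteq> i" for l
      using low[of l i] lowU[of i l] that \<open>i < n\<close> by (cases "l < i") auto
    then have "(U ^\<^sub>m Suc k) $$ (i, i) = (\<Sum>l\<in>{i}. (U ^\<^sub>m k) $$ (i, l) * U $$ (l, i))"
      unfolding entry[OF that that] using that by (intro sum.mono_neutral_right) auto
    then show ?thesis
      using Suc that by (simp add: power_commutes)
  qed
  ultimately show ?case
    using U car by (auto intro!: upper_triangularI)
qed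

text \<open>A complex Schur decomposition A = P U Q reduces both sides to the diagonal of the
  triangular \<open>U\<close>: the determinant becomes a product of linear factors, the traces
  become power sums.\<close>

lemma log_deriv_det:
  fixes A :: "complex mat"
  assumes A: "A \<in> carrier_mat n n"
  shows "log_deriv (det (1\<^sub>m n - fps_X \<cdot>\<^sub>m map_mat fps_const A))
    (power_sum_fps 1 (\<lambda>k. trace_mat (A ^\<^sub>m k)))"
proof -
  obtain as where as: "char_poly A = (\<Prod>a\<leftarrow>as. [:- a, 1:])"
    using char_poly_factorized[OF A] by auto
  obtain U P Q where UPQ: "schur_decomposition A as = (U, P, Q)"
    by (cases "schur_decomposition A as") auto
  then have wit: "similar_mat_wit A U P Q" and tri: "upper_triangular U"
    using schur_decomposition[OF A as UPQ] by auto
  note w = similar_mat_witD2[OF A wit]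
  note car = w(5-7)
  let ?h = "map_mat fps_const :: complex mat \<Rightarrow> complex fps mat"
  let ?D = "1\<^sub>m n - fps_X \<cdot>\<^sub>m ?h U"
  have PQ: "?h P * ?h Q = 1\<^sub>m n"
    using fps_const_hom.mat_hom_mult[OF car(2,3)] w(1) by (simp add: fps_const_hom.mat_hom_one)
  have hA: "?h A = ?h P * ?h U * ?h Q"
    using w(3) car by (simp add: fps_const_hom.mat_hom_mult[of _ n n _ n])
  have D: "?D \<in> carrier_mat n n"
    using car by (intro minus_carrier_mat smult_carrier_mat) simp
  have "1\<^sub>m n - fps_X \<cdot>\<^sub>m ?h A = ?h P * ?D * ?h Q"
  proof -
    have "?h P * ?D = ?h P - fps_X \<cdot>\<^sub>m (?h P * ?h U)"
      using car by (simp add: mult_minus_distrib_mat[of _ n n _ n] mult_smult_distrib[of _ n n _ n])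
    then have "?h P * ?D * ?h Q = ?h P * ?h Q - fps_X \<cdot>\<^sub>m (?h P * ?h U * ?h Q)"
      using car by (simp add: minus_mult_distrib_mat[of _ n n _ _ n] mult_smult_assoc_mat[of _ n n _ n])
    then show ?thesis
      by (simp add: PQ hA)
  qed
  then have "det (1\<^sub>m n - fps_X \<cdot>\<^sub>m ?h A) = det (?h P) * det ?D * det (?h Q)"
    using car D by (simp add: det_mult[of _ n])
  also have "\<dots> = det (?h P * ?h Q) * det ?D"
    using car by (simp add: det_mult[of _ n])
  also have "\<dots> = det ?D"
    by (simp add: PQ)
  \<comment> \<open>The exponent 1 is kept to match \<open>log_deriv_linear\<close> with l =
    1.\<close>
  also have "\<dots> = (\<Prod>i\<in>{0..<n}. 1 - fps_const (U $$ (i, i)) * fps_X ^ 1)"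
  proof -
    have "upper_triangular ?D"
      using tri car by (intro upper_triangularI) (auto simp: upper_triangularD)
    then show ?thesis
      using car by (subst det_upper_triangular[OF _ D])
        (auto simp: prod_list_diag_prod mult.commute intro!: prod.cong)
  qed
  finally have det: "det (1\<^sub>m n - fps_X \<cdot>\<^sub>m ?h A) = \<dots>" .
  \<comment> \<open>Cyclicity of the trace brings \<open>Q\<close> and \<open>P\<close> together,
    where they cancel.\<close>
  have "trace_mat (A ^\<^sub>m k) = (\<Sum>i\<in>{0..<n}. (U $$ (i, i)) ^ k)" for k
  proof -
    note wk = similar_mat_witD2[OF pow_carrier_mat[OF A] similar_mat_wit_pow[OF wit, of k]]
    have "trace_mat (A ^\<^sub>m k) = trace_mat (P * (U ^\<^sub>m k * Q))"
      using wk by (metis assoc_mult_mat)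
    also have "\<dots> = trace_mat (U ^\<^sub>m k * Q * P)"
      using wk by (intro trace_mat_mult_commute) auto
    also have "\<dots> = trace_mat (U ^\<^sub>m k * (Q * P))"
      using wk by (metis assoc_mult_mat)
    also have "\<dots> = trace_mat (U ^\<^sub>m k)"
      using wk right_mult_one_mat[OF wk(5)] by simp
    finally show ?thesis
      using upper_triangular_pow[OF car(1) tri, of k] car
      by (simp add: trace_mat_def atLeast0LessThan)
  qed
  moreover have "(\<Sum>i\<in>{0..<n}. power_sum_fps 1 (\<lambda>k. (U $$ (i, i)) ^ k)) =
      power_sum_fps 1 (\<lambda>k. \<Sum>i\<in>{0..<n}. (U $$ (i, i)) ^ k)"
    by (rule fps_ext) (simp add: fps_sum_nth power_sum_fps_def)
  moreover have "log_deriv (\<Prod>i\<in>{0..<n}. 1 - fps_const (U $$ (i, i)) * fps_X ^ 1)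
      (\<Sum>i\<in>{0..<n}. power_sum_fps 1 (\<lambda>k. (U $$ (i, i)) ^ k))"
    by (intro log_deriv_prod log_deriv_linear) simp_all
  ultimately show ?thesis
    unfolding det by simp
qed

section \<open>Weights of cyclic words\<close>

fun walk_weight :: "'a::{monoid_mult} mat \<Rightarrow> nat list \<Rightarrow> 'a" where
  "walk_weight M (x # y # zs) = M $$ (x, y) * walk_weight M (y # zs)"
| "walk_weight M _ = 1"

text \<open>Repeating the first letter supplies the closing factor; the empty word becomes a
  one-letter walk of weight 1.\<close>

definition cyclic_weight :: "'a::{monoid_mult} mat \<Rightarrow> nat list \<Rightarrow> 'a" where
  "cyclic_weight M ws = walk_weight M (ws @ [hd ws])"

lemma walk_weight_append:
  "walk_weight M (xs @ y # zs) = walk_weight M (xs @ [y]) * walk_weight M (y # zs)"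
proof (induction xs)
  case (Cons x xs)
  then show ?case
    by (cases xs) (simp_all add: mult.assoc)
qed simp

text \<open>Two cuts leave two open walks, each ending on the first letter of the other; exchanging
  them rotates the word.\<close>

lemma cyclic_weight_append:
  assumes "us \<noteq> []" "vs \<noteq> []"
  shows "cyclic_weight M (us @ vs) = walk_weight M (us @ [hd vs]) * walk_weight M (vs @ [hd us])"
proof -
  obtain v vs' where "vs = v # vs'"
    using assms by (cases vs) auto
  then show ?thesis
    using assms walk_weight_append[of M us v "vs' @ [hd us]"] by (simp add: cyclic_weight_def)
qed

lemma cyclic_weight_power:
  "cyclic_weight M (concat (replicate n us)) = cyclic_weight M us ^ n"
proof (cases "us = []")
  case True
  have "cyclic_weight M [] = 1"
    by (simp add: cyclic_weight_def)
  then show ?thesis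
    using True by simp
next
  case False
  show ?thesis
  proof (induction n)
    case (Suc n)
    show ?case
    proof (cases n)
      case (Suc n')
      \<comment> \<open>The remaining power starts with the same letter as \<open>us\<close>, so
        both cut pieces are again cyclic weights.\<close>
      have "concat (replicate n us) \<noteq> []" "hd (concat (replicate n us)) = hd us"
        using False Suc by auto
      then show ?thesis
        using False Suc.IH cyclic_weight_append[of us "concat (replicate n us)" M]
        by (simp add: cyclic_weight_def)
    qed (simp add: cyclic_weight_def)
  qed (simp add: cyclic_weight_def)
qed

lemma sum_words_Cons:
  "(\<Sum>ws\<in>words N (Suc k). f ws) = (\<Sum>j<N. \<Sum>ws\<in>words N k. f (j # ws))"
proof -
  have "bij_betw (\<lambda>(j, ws). j # ws) ({..<N} \<times> words N k) (words N (Suc k))"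
    unfolding bij_betw_def by (auto simp: inj_on_def words_def length_Suc_conv image_iff)
  from sum.reindex_bij_betw[OF this, of f] show ?thesis
    by (simp add: sum.cartesian_product case_prod_beta)
qed

lemma sum_words_snoc:
  "(\<Sum>ws\<in>words N (Suc k). f ws) = (\<Sum>ws\<in>words N k. \<Sum>j<N. f (ws @ [j]))"
proof -
  have "bij_betw (\<lambda>(ws, j). ws @ [j]) (words N k \<times> {..<N}) (words N (Suc k))"
    unfolding bij_betw_def by (auto simp: inj_on_def words_def length_Suc_conv_rev image_iff)
  from sum.reindex_bij_betw[OF this, of f] show ?thesis
    by (simp add: sum.cartesian_product case_prod_beta)
qed

text \<open>\<open>Suc k\<close> factors leave \<open>k\<close> interior letters to sum over. New
  letters are appended on the right, which respects the order of the noncommuting entries.\<close>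

lemma pow_mat_eq_sum_walks:
  fixes M :: "'a::semiring_1 mat"
  assumes M: "M \<in> carrier_mat N N" and "r < N" "s < N"
  shows "(M ^\<^sub>m Suc k) $$ (r, s) = (\<Sum>ws\<in>words N k. walk_weight M (r # ws @ [s]))"
  using \<open>s < N\<close>
proof (induction k arbitrary: s)
  case 0
  have "words N 0 = {[]}"
    by (auto simp: words_def)
  then show ?case
    using M 0 \<open>r < N\<close> by simp
next
  case (Suc k)
  have car: "M ^\<^sub>m Suc k \<in> carrier_mat N N"
    using M by (rule pow_carrier_mat)
  have "(M ^\<^sub>m Suc (Suc k)) $$ (r, s) = (\<Sum>j<N. (M ^\<^sub>m Suc k) $$ (r, j) * M $$ (j, s))"
    using M car Suc.prems \<open>r < N\<close>
    by (simp only: pow_mat.simps(2)[of M "Suc k"] index_mult_mat carrier_matD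
        scalar_prod_def dim_col index_row index_col atLeast0LessThan) (simp add: scalar_prod_def atLeast0LessThan)
  also have "\<dots> = (\<Sum>j<N. \<Sum>ws\<in>words N k. walk_weight M (r # ws @ [j]) * M $$ (j, s))"
    using Suc.IH by (simp add: sum_distrib_right del: pow_mat.simps)
  also have "\<dots> = (\<Sum>ws\<in>words N k. \<Sum>j<N. walk_weight M (r # ws @ [j]) * M $$ (j, s))"
    by (rule sum.swap)
  also have "\<dots> = (\<Sum>ws\<in>words N (Suc k). walk_weight M (r # ws @ [s]))"
    using walk_weight_append[of M "r # ws" j "[s]" for ws j] by (simp add: sum_words_snoc)
  finally show ?case .
qed

lemma trace_mat_pow_eq_sum_cyclic_weight:
  fixes M :: "'a::semiring_1 mat"
  assumes M: "M \<in> carrier_mat N N" and "k > 0"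
  shows "trace_mat (M ^\<^sub>m k) = (\<Sum>ws\<in>words N k. cyclic_weight M ws)"
proof -
  obtain k' where k: "k = Suc k'"
    using \<open>k > 0\<close> by (cases k) auto
  have "dim_row (M ^\<^sub>m k) = N"
    using M by (cases k) auto
  then have "trace_mat (M ^\<^sub>m k) = (\<Sum>i<N. \<Sum>ws\<in>words N k'. walk_weight M (i # ws @ [i]))"
    using pow_mat_eq_sum_walks[OF M] by (simp add: trace_mat_def k del: pow_mat.simps)
  then show ?thesis
    by (simp add: k sum_words_Cons cyclic_weight_def)
qed

section \<open>The Study determinant as a product over Lyndon words\<close>

lemma simplex_perplex_0 [simp]: "simplex_part 0 = 0" "perplex_part 0 = 0"
  by (simp_all add: simplex_part_def perplex_part_def complex_eq_iff)

lemma simplex_perplex_add: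
  "simplex_part (x + y) = simplex_part x + simplex_part y"
  "perplex_part (x + y) = perplex_part x + perplex_part y"
  by (simp_all add: simplex_part_def perplex_part_def complex_eq_iff)

text \<open>This reflects the commutation rule z j = j cnj(z) for complex z.\<close>

lemma simplex_perplex_mult:
  "simplex_part (x * y) = simplex_part x * simplex_part y - cnj (perplex_part x) * perplex_part y"
  "perplex_part (x * y) = perplex_part x * simplex_part y + cnj (simplex_part x) * perplex_part y"
  by (simp_all add: simplex_part_def perplex_part_def complex_eq_iff)

text \<open>Handles one block of \<open>psi_mult\<close>: the additive \<open>h\<close> passes
  through scalar products, and its two-term product rule becomes an entry of a 2 by 2 block
  product.\<close>

lemma map_mat_mult_four_block:
  fixes A B :: "'a::semiring_0 mat" and h f g f' g' :: "'a \<Rightarrow> 'b::semiring_0"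
  assumes "A \<in> carrier_mat n m" "B \<in> carrier_mat m p"
    and h0: "h 0 = 0" and add: "\<And>x y. h (x + y) = h x + h y"
    and mult: "\<And>x y. h (x * y) = f x * g y + f' x * g' y"
  shows "map_mat h (A * B) = map_mat f A * map_mat g B + map_mat f' A * map_mat g' B"
proof -
  have "h (sum F S) = (\<Sum>i\<in>S. h (F i))" for F and S :: "nat set"
    by (induction S rule: infinite_finite_induct) (simp_all add: h0 add)
  then show ?thesis
    using assms by (intro eq_matI) (auto simp: scalar_prod_def mult sum.distrib)
qed

lemma psi_carrier: "M \<in> carrier_mat n m \<Longrightarrow> psi M \<in> carrier_mat (2 * n) (2 * m)"
  by (auto simp: psi_def)

lemma psi_mult:
  assumes "A \<in> carrier_mat n m" "B \<in> carrier_mat m p"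
  shows "psi (A * B) = psi A * psi B"
proof -
  note mm = map_mat_mult_four_block[OF assms]
  show ?thesis
    unfolding psi_def using assms
    by (subst mult_four_block_mat[where ?nr1.0 = n and ?nr2.0 = n and ?n1.0 = m and ?n2.0 = m
          and ?nc1.0 = p and ?nc2.0 = p], simp_all)
      (intro arg_cong4[of _ _ _ _ _ _ _ _ four_block_mat] mm,
        simp_all add: simplex_perplex_add simplex_perplex_mult algebra_simps)
qed

lemma psi_one: "psi (1\<^sub>m n) = 1\<^sub>m (2 * n)"
proof -
  have "simplex_part 1 = 1" "perplex_part 1 = 0"
    by (simp_all add: simplex_part_def perplex_part_def complex_eq_iff)
  then show ?thesis
    by (intro eq_matI) (auto simp: psi_def)
qed

lemma psi_pow:
  assumes "M \<in> carrier_mat n n"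
  shows "psi (M ^\<^sub>m k) = psi M ^\<^sub>m k"
proof (induction k)
  case 0
  have "dim_row (psi M) = 2 * n" "dim_row M = n"
    using assms psi_carrier by auto
  then show ?case
    by (simp add: psi_one)
next
  case (Suc k)
  then show ?case
    using assms psi_mult[of "M ^\<^sub>m k" n n M n] by simp
qed

text \<open>The two diagonal blocks contribute complex conjugate numbers, whose sum is twice the
  real part.\<close>

lemma trace_mat_psi:
  assumes "M \<in> carrier_mat n n"
  shows "trace_mat (psi M) = of_real (2 * q0 (trace_mat M))"
proof -
  have split: "(\<Sum>i<n + k. f i) = (\<Sum>i<n. f i) + (\<Sum>i<k. f (n + i))" for k and f :: "nat \<Rightarrow> complex"
    by (induction k) (simp_all add: add.assoc)
  have "trace_mat (psi M) = (\<Sum>i<n. simplex_part (M $$ (i, i)) + cnj (simplex_part (M $$ (i, i))))"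
    using assms by (simp add: trace_mat_def psi_def split sum.distrib)
  also have "\<dots> = (\<Sum>i<n. of_real (2 * q0 (M $$ (i, i))))"
    by (intro sum.cong) (simp_all add: simplex_part_def complex_eq_iff)
  also have "\<dots> = of_real (2 * (\<Sum>i<n. q0 (M $$ (i, i))))"
    by (simp add: sum_distrib_left)
  also have "(\<Sum>i<n. q0 (M $$ (i, i))) = q0 (\<Sum>i<n. M $$ (i, i))"
    by (induction n) simp_all
  finally show ?thesis
    using assms by (simp add: trace_mat_def)
qed

text \<open>The only nonzero coefficient matrices of the pencil are the identity at t^0 and
  \<open>- M\<close> at t^1, and \<open>psi\<close> respects both.\<close>

lemma psi_t_one_minus:
  assumes "M \<in> carrier_mat n n"
  shows "psi_t (1\<^sub>m n - fps_X \<cdot>\<^sub>m map_mat fps_const M) =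
    1\<^sub>m (2 * n) - fps_X \<cdot>\<^sub>m map_mat fps_const (psi M)"
proof (rule eq_matI)
  fix r s assume "r < dim_row (1\<^sub>m (2 * n) - fps_X \<cdot>\<^sub>m map_mat fps_const (psi M))"
    "s < dim_col (1\<^sub>m (2 * n) - fps_X \<cdot>\<^sub>m map_mat fps_const (psi M))"
  then have rs: "r < 2 * n" "s < 2 * n"
    using psi_carrier[OF assms] by auto
  define K where "K k = map_mat (\<lambda>a. fps_nth a k) (1\<^sub>m n - fps_X \<cdot>\<^sub>m map_mat fps_const M)" for k
  have "K k = (if k = 0 then 1\<^sub>m n else if k = 1 then - M else 0\<^sub>m n n)" for k
    using assms by (intro eq_matI) (auto simp: K_def)
  moreover have "psi (- M) = - psi M"
    using assms by (intro eq_matI) (auto simp: psi_def simplex_part_def perplex_part_def complex_eq_iff)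
  moreover have "psi (0\<^sub>m n n) = 0\<^sub>m (2 * n) (2 * n)"
    by (intro eq_matI) (auto simp: psi_def)
  ultimately have "psi (K k) = (if k = 0 then 1\<^sub>m (2 * n) else if k = 1 then - psi M else 0\<^sub>m (2 * n) (2 * n))" for k
    by (simp add: psi_one)
  moreover have "dim_row (psi M) = 2 * n" "dim_col (psi M) = 2 * n"
    using psi_carrier[OF assms] by auto
  moreover have "psi_t (1\<^sub>m n - fps_X \<cdot>\<^sub>m map_mat fps_const M) $$ (r, s) = Abs_fps (\<lambda>k. psi (K k) $$ (r, s))"
    using assms rs by (simp add: psi_t_def K_def)
  ultimately show "psi_t (1\<^sub>m n - fps_X \<cdot>\<^sub>m map_mat fps_const M) $$ (r, s) =
      (1\<^sub>m (2 * n) - fps_X \<cdot>\<^sub>m map_mat fps_const (psi M)) $$ (r, s)"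
    using rs by (intro fps_ext) auto
qed (use assms psi_carrier[OF assms] in \<open>auto simp: psi_t_def\<close>)

section \<open>Norm polynomials and comparison of coefficients\<close>

lemma q0_mult_commute: "q0 (x * y) = q0 (y * x)"
  by simp

text \<open>Rotation exchanges the two walks obtained by cutting off the first letter, and the real
  part of a product is symmetric in its factors.\<close>

lemma q0_cyclic_weight_rotate1: "q0 (cyclic_weight M (rotate1 ws)) = q0 (cyclic_weight M ws)"
proof (cases "length ws \<le> 1")
  case False
  then obtain x xs where ws: "ws = [x] @ xs" "xs \<noteq> []"
    by (cases ws) auto
  have "rotate1 ws = xs @ [x]"
    using ws by simp
  then show ?thesis
    using ws q0_mult_commute by (simp only: cyclic_weight_append not_Cons_self2 simp_thms)
qed simp

lemma log_deriv_Sdet: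
  assumes M: "M \<in> carrier_mat N N"
  shows "log_deriv (Sdet_t (1\<^sub>m N - fps_X \<cdot>\<^sub>m map_mat fps_const M))
    (power_sum_fps 1 (\<lambda>k. of_real (2 * q0 (trace_mat (M ^\<^sub>m k)))))"
  using log_deriv_det[OF psi_carrier[OF M]]
  by (simp add: Sdet_t_def psi_t_one_minus[OF M] trace_mat_psi[OF pow_carrier_mat[OF M]]
      flip: psi_pow[OF M])

text \<open>The product of 1 - x t^l and its conjugate has real coefficients; it is placed in the
  commutative ring of complex series, where \<open>prod\<close> and \<open>log_deriv\<close> make
  sense.\<close>

definition quat_norm_poly :: "quat \<Rightarrow> nat \<Rightarrow> complex fps" where
  "quat_norm_poly x l = 1 - fps_const (of_real (2 * q0 x)) * fps_X ^ l
    + fps_const (of_real (quat_normsq x)) * fps_X ^ (2 * l)"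

text \<open>A quaternion satisfies the quadratic equation of its norm polynomial, so the traces of its
  powers are the power sums of the two complex roots.\<close>

lemma log_deriv_quat_norm_poly:
  assumes "l > 0"
  shows "log_deriv (quat_norm_poly x l) (power_sum_fps l (\<lambda>k. of_real (2 * q0 (x ^ k))))"
proof -
  define s where "s = sqrt ((q1 x)\<^sup>2 + (q2 x)\<^sup>2 + (q3 x)\<^sup>2)"
  \<comment> \<open>\<open>a\<close> and \<open>cnj a\<close> are the roots: they share the real
    part of \<open>x\<close>, and \<open>s\<close> is the length of its vector part.\<close>
  define a where "a = Complex (q0 x) s"
  have s: "s\<^sup>2 = (q1 x)\<^sup>2 + (q2 x)\<^sup>2 + (q3 x)\<^sup>2"
    by (simp add: s_def)
  have tr: "a + cnj a = of_real (2 * q0 x)" and nm: "a * cnj a = of_real (quat_normsq x)"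
    using s by (simp_all add: a_def quat_normsq_def complex_eq_iff power2_eq_square)
  have step: "c ^ Suc (Suc k) = (a + cnj a) * c ^ Suc k - a * cnj a * c ^ k" if "c = a \<or> c = cnj a" for c k
    using that by (auto simp: algebra_simps)
  \<comment> \<open>Real part of the quadratic equation of \<open>x\<close>, multiplied on the right
    by \<open>y\<close>.\<close>
  have q: "q0 (x * (x * y)) = 2 * q0 x * q0 (x * y) - quat_normsq x * q0 y" for y
    by (simp add: quat_normsq_def power2_eq_square algebra_simps)
  \<comment> \<open>The recursion has order two, so two consecutive exponents are carried
    along.\<close>
  have "a ^ k + cnj a ^ k = of_real (2 * q0 (x ^ k)) \<and>
      a ^ Suc k + cnj a ^ Suc k = of_real (2 * q0 (x ^ Suc k))" for k
  proof (induction k)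
    case 0
    then show ?case using tr by simp
  next
    case (Suc k)
    have "a ^ Suc (Suc k) + cnj a ^ Suc (Suc k) =
        (a + cnj a) * (a ^ Suc k + cnj a ^ Suc k) - a * cnj a * (a ^ k + cnj a ^ k)"
      unfolding step[of a, OF disjI1[OF refl]] step[of "cnj a", OF disjI2[OF refl]]
      by (simp only: right_diff_distrib distrib_left algebra_simps)
    also have "\<dots> = of_real (2 * (2 * q0 x * q0 (x ^ Suc k) - quat_normsq x * q0 (x ^ k)))"
      using Suc by (simp only: tr nm) (simp add: algebra_simps del: power_Suc)
    also have "\<dots> = of_real (2 * q0 (x ^ Suc (Suc k)))"
      using q[of "x ^ k"] by (simp only: power_Suc)
    finally show ?case
      using Suc by simp
  qed
  then have pw: "(\<lambda>k. a ^ k + cnj a ^ k) = (\<lambda>k. of_real (2 * q0 (x ^ k)))"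
    by blast
  have "(1 - fps_const a * fps_X ^ l) * (1 - fps_const (cnj a) * fps_X ^ l) =
      1 - fps_const (a + cnj a) * fps_X ^ l + fps_const (a * cnj a) * fps_X ^ (2 * l)"
    by (simp add: algebra_simps power_add mult_2_right flip: fps_const_add fps_const_mult)
  then have "quat_norm_poly x l = (1 - fps_const a * fps_X ^ l) * (1 - fps_const (cnj a) * fps_X ^ l)"
    by (simp only: quat_norm_poly_def tr nm)
  moreover have "log_deriv \<dots> (power_sum_fps l (\<lambda>k. of_real (2 * q0 (x ^ k))))"
    using log_deriv_mult[OF log_deriv_linear[OF assms, of a] log_deriv_linear[OF assms, of "cnj a"]]
    by (simp only: power_sum_fps_add pw)
  ultimately show ?thesis
    by simp
qed

text \<open>Coefficient \<open>j\<close> of the logarithmic derivative sees only Lyndon words whose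
  length divides \<open>j\<close>; hence a finite \<open>L\<close> containing those up to length
  \<open>n\<close> of nonzero weight determines all coefficients up to \<open>n\<close>.\<close>

lemma Sdet_nth_eq_lyndon_prod_nth:
  assumes M: "M \<in> carrier_mat N N" and L: "finite L" "L \<subseteq> lyndon_words N"
    and cover: "\<And>u. u \<in> lyndon_words N \<Longrightarrow> length u \<le> n \<Longrightarrow> cyclic_weight M u \<noteq> 0 \<Longrightarrow> u \<in> L"
    and "k \<le> n"
  shows "fps_nth (\<Prod>u\<in>L. quat_norm_poly (cyclic_weight M u) (length u)) k =
    fps_nth (Sdet_t (1\<^sub>m N - fps_X \<cdot>\<^sub>m map_mat fps_const M)) k"
proof (rule log_deriv_determines[OF log_deriv_prod[OF L(1)] log_deriv_Sdet[OF M] _ \<open>k \<le> n\<close>])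
  let ?P = "\<lambda>u. power_sum_fps (length u) (\<lambda>k. of_real (2 * q0 (cyclic_weight M u ^ k))) :: complex fps"
  show "log_deriv (quat_norm_poly (cyclic_weight M u) (length u)) (?P u)" if "u \<in> L" for u
    using that L by (intro log_deriv_quat_norm_poly) (auto simp: lyndon_words_def)
  fix j assume j: "0 < j" "j \<le> n"
  let ?A = "{u \<in> lyndon_words N. length u dvd j}"
  let ?f = "\<lambda>u. of_real (of_nat (length u) * (2 * q0 (cyclic_weight M u ^ (j div length u)))) :: complex"
  have finA: "finite ?A"
  proof (rule finite_subset)
    show "?A \<subseteq> {xs. set xs \<subseteq> {0..<N} \<and> length xs \<le> j}"
      using j by (auto simp: lyndon_words_def dest: dvd_imp_le)
  qed (rule finite_lists_length_le, simp)
  have "fps_nth (sum ?P L) j = (\<Sum>u\<in>L. if length u dvd j then ?f u else 0)"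
    using j by (simp add: fps_sum_nth power_sum_fps_def cong: if_cong)
  also have "\<dots> = (\<Sum>u\<in>{u\<in>L. length u dvd j}. ?f u)"
    by (rule sum.inter_filter[OF L(1), symmetric])
  \<comment> \<open>Words missing from \<open>L\<close> have weight 0, and their exponent
    \<open>j div length u\<close> is positive.\<close>
  also have "\<dots> = sum ?f ?A"
  proof (rule sum.mono_neutral_left[OF finA])
    show "{u \<in> L. length u dvd j} \<subseteq> ?A"
      using L(2) by auto
    show "\<forall>u\<in>?A - {u \<in> L. length u dvd j}. ?f u = 0"
    proof
      fix u assume u: "u \<in> ?A - {u \<in> L. length u dvd j}"
      then have "length u \<le> n"
        using j dvd_imp_le[of "length u" j] by simp
      then have "cyclic_weight M u = 0"
        using cover[of u] u by blast
      moreover have "j div length u > 0"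
        using u j by (auto simp: dvd_div_eq_0_iff)
      ultimately show "?f u = 0"
        by (simp add: zero_power)
    qed
  qed
  \<comment> \<open>The grouping of words by Lyndon powers is read backwards; the weight of a power
    is the power of the weight.\<close>
  also have "\<dots> = of_real (\<Sum>ws\<in>words N j. 2 * q0 (cyclic_weight M ws))"
    using sum_words_eq_sum_lyndon_words[of "\<lambda>ws. 2 * q0 (cyclic_weight M ws)" j N] j
    by (simp add: q0_cyclic_weight_rotate1 cyclic_weight_power)
  also have "(\<Sum>ws\<in>words N j. 2 * q0 (cyclic_weight M ws)) = 2 * q0 (trace_mat (M ^\<^sub>m j))"
  proof -
    have "q0 (sum F S) = (\<Sum>i\<in>S. q0 (F i))" for F and S :: "nat list set"
      by (induction S rule: infinite_finite_induct) simp_all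
    then show ?thesis
      using j by (simp add: trace_mat_pow_eq_sum_cyclic_weight[OF M] sum_distrib_left)
  qed
  finally show "fps_nth (sum ?P L) j =
      fps_nth (power_sum_fps 1 (\<lambda>k. of_real (2 * q0 (trace_mat (M ^\<^sub>m k))))) j"
    using j by (simp add: power_sum_fps_def)
qed

section \<open>Transfer from complex to quaternionic power series\<close>

lemma quat_of_complex_ring:
  "quat_of_complex 0 = 0" "quat_of_complex 1 = 1"
  "quat_of_complex (a + b) = quat_of_complex a + quat_of_complex b"
  "quat_of_complex (a * b) = quat_of_complex a * quat_of_complex b"
  by (simp_all add: quat_of_complex_def quat_eq_iff)

lemma fps_quat_of_complex_1: "fps_quat_of_complex 1 = 1"
  by (rule fps_ext) (simp add: fps_quat_of_complex_def quat_of_complex_ring)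

lemma fps_quat_of_complex_mult:
  "fps_quat_of_complex (f * g) = fps_quat_of_complex f * fps_quat_of_complex g"
proof -
  have "quat_of_complex (sum F S) = (\<Sum>i\<in>S. quat_of_complex (F i))" for F and S :: "nat set"
    by (induction S rule: infinite_finite_induct) (simp_all add: quat_of_complex_ring)
  then show ?thesis
    by (intro fps_ext) (simp add: fps_quat_of_complex_def fps_mult_nth quat_of_complex_ring)
qed

text \<open>The image of the inverse is a left inverse, \<open>inverse\<close> of the image is a
  right inverse, and the two must coincide.\<close>

lemma fps_quat_of_complex_inverse:
  assumes "fps_nth f 0 = 1"
  shows "fps_quat_of_complex (inverse f) = inverse (fps_quat_of_complex f)"
proof -
  let ?g = "fps_quat_of_complex f"
  have "fps_nth ?g 0 = 1"
    using assms by (simp add: fps_quat_of_complex_def quat_of_complex_ring)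
  then have g: "?g * inverse ?g = 1"
    by (intro inverse_mult_eq_1') simp
  have "fps_quat_of_complex (inverse f) * ?g = 1"
    using assms by (simp add: inverse_mult_eq_1 fps_quat_of_complex_1 flip: fps_quat_of_complex_mult)
  then show ?thesis
    using g by (metis mult.assoc mult.left_neutral mult.right_neutral)
qed

lemma cycle_series_norm:
  assumes "C \<noteq> []"
  shows "cycle_series w C * fps_quat_cnj (cycle_series w C) =
    fps_quat_of_complex (quat_norm_poly (path_weight w C) (length C))"
proof -
  have "cycle_series w C * fps_quat_cnj (cycle_series w C) =
      1 - fps_const (path_weight w C + quat_cnj (path_weight w C)) * fps_X ^ length C
      + fps_const (path_weight w C * quat_cnj (path_weight w C)) * fps_X ^ (2 * length C)"
    unfolding cycle_series_def using assms by (intro cycle_factor_eq) simp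
  also have "\<dots> = fps_quat_of_complex (quat_norm_poly (path_weight w C) (length C))"
    by (rule fps_ext)
      (auto simp: fps_quat_of_complex_def quat_norm_poly_def quat_of_complex_def quat_eq_iff
        quat_cnj_def quat_normsq_def power2_eq_square)
  finally show ?thesis .
qed

section \<open>Reduced cycles and the zeta function\<close>

text \<open>Recasts the recursive walk predicate as a condition on neighbouring arcs, the form
  shared with backtracking.\<close>

lemma pcas_iff_successively:
  assumes "p \<noteq> []"
  shows "pcas u p v \<longleftrightarrow>
    fst (hd p) = u \<and> successively (\<lambda>a b. snd a = fst b) p \<and> snd (last p) = v"
  using assms
proof (induction p arbitrary: u)
  case (Cons a p)
  show ?case
  proof (cases p)
    case (Cons b q)
    then have "pcas (snd a) p v \<longleftrightarrow>
        fst (hd p) = snd a \<and> successively (\<lambda>a b. snd a = fst b) p \<and> snd (last p) = v"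
      by (intro Cons.IH) simp
    then show ?thesis
      using Cons by (simp only: pcas.simps successively.simps list.sel last.simps list.distinct if_False)
        metis
  qed simp
qed simp

lemma has_backtracking_iff:
  "has_backtracking P \<longleftrightarrow> \<not> successively (\<lambda>a b. b \<noteq> prod.swap a) P"
  by (auto simp: has_backtracking_def successively_conv_nth)

lemma successively_conj:
  "successively P xs \<and> successively Q xs \<longleftrightarrow> successively (\<lambda>a b. P a b \<and> Q a b) xs"
  by (auto simp: successively_conv_nth)

lemma successively_snoc_hd:
  "C \<noteq> [] \<Longrightarrow> successively P (C @ [hd C]) \<longleftrightarrow> successively P C \<and> P (last C) (hd C)"
  by (simp add: successively_append_iff)

text \<open>The only new neighbours in \<open>C @ C\<close> are \<open>last C\<close> and
  \<open>hd C\<close>, which are also the arcs that must meet to close the walk;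
  \<open>C @ [hd C]\<close> records this pair.\<close>

lemma reduced_cycle_iff:
  assumes "pair_graph G" "C \<noteq> []" "set C \<subseteq> parcs G"
  shows "reduced_cycle G C \<longleftrightarrow>
    successively (\<lambda>a b. snd a = fst b \<and> b \<noteq> prod.swap a) (C @ [hd C])"
proof -
  interpret pair_graph G by fact
  have "hd C \<in> parcs G"
    using assms by auto
  then have "fst (hd C) \<in> pverts G"
    using in_arcsD1 wellformed by auto
  then have "closed_w C \<longleftrightarrow> successively (\<lambda>a b. snd a = fst b) (C @ [hd C])"
    unfolding closed_w_def awalk_def successively_snoc_hd[OF assms(2)] cas_with_proj_eq
      pcas_iff_successively[OF assms(2)]
    using assms(2,3) by (metis length_greater_0_conv)
  moreover have "\<not> has_backtracking C \<and> \<not> has_backtracking (C @ C) \<longleftrightarrow>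
      successively (\<lambda>a b. b \<noteq> prod.swap a) (C @ [hd C])"
    unfolding has_backtracking_iff successively_append_iff using assms(2) by simp
  ultimately show ?thesis
    by (simp add: reduced_cycle_def successively_conj)
qed

text \<open>One forbidden transition annihilates the product. The value of an entry comes from its
  row, so the last letter adds no factor, hence \<open>butlast\<close>.\<close>

lemma walk_weight_if_successively:
  assumes "\<And>r s. r \<in> set xs \<Longrightarrow> s \<in> set xs \<Longrightarrow> M $$ (r, s) = (if R r s then c r else 0)"
  shows "walk_weight M xs =
    (if successively R xs then prod_list (map c (butlast xs)) else (0 :: 'a::semiring_1))"
  using assms by (induction M xs rule: walk_weight.induct) auto

theorem theorem7p1:
  fixes G :: "'v pair_pre_digraph" and m :: nat
    and e :: "nat \<Rightarrow> 'v \<times> 'v" and w :: "'v \<times> 'v \<Rightarrow> quat"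
  assumes "pair_graph G" and "connected (with_proj G)"
    and "arc_enumeration G m e"
    and "quaternionic_weight G w"
  shows "inverse (zeta_H G m e w) =
    fps_quat_of_complex
      (Sdet_t (1\<^sub>m (2 * m) - fps_X \<cdot>\<^sub>m map_mat fps_const (B_mat m e w - J_mat m e w)))"
proof -
  define N where "N = 2 * m"
  define M where "M = B_mat m e w - J_mat m e w"
  define S where "S = Sdet_t (1\<^sub>m N - fps_X \<cdot>\<^sub>m map_mat fps_const M)"
  define R where "R = (\<lambda>r s. snd (e r) = fst (e s) \<and> e s \<noteq> prod.swap (e r))"
  have M: "M \<in> carrier_mat N N"
    unfolding M_def B_mat_def J_mat_def N_def by (intro minus_carrier_mat) simp
  \<comment> \<open>The reverse of an arc starts where the arc ends, so \<open>J_mat\<close> cancels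
    exactly the backtracking entries of \<open>B_mat\<close>.\<close>
  have M_nth: "M $$ (r, s) = (if R r s then w (e r) else 0)" if "r < N" "s < N" for r s
    using that by (auto simp: M_def B_mat_def J_mat_def N_def R_def)
  have e: "bij_betw e {0..<N} (parcs G)"
    using assms(3) by (simp add: arc_enumeration_def N_def)
  have reduced: "reduced_cycle G (map e u) \<longleftrightarrow> successively R (u @ [hd u])"
    and weight: "cyclic_weight M u =
      (if reduced_cycle G (map e u) then path_weight w (map e u) else 0)"
    if u: "u \<in> lyndon_words N" for u
  proof -
    have u': "u \<noteq> []" "set u \<subseteq> {0..<N}"
      using u by (auto simp: lyndon_words_def)
    then have "set (map e u) \<subseteq> parcs G"
      using e by (auto simp: bij_betw_def)
    then show "reduced_cycle G (map e u) \<longleftrightarrow> successively R (u @ [hd u])"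
      using u' assms(1) successively_map[of _ e "u @ [hd u]"]
      by (subst reduced_cycle_iff) (auto simp: hd_map R_def)
    moreover have "r < N" if "r \<in> set (u @ [hd u])" for r
      using that u' hd_in_set[of u] by (auto simp del: hd_in_set)
    then have "walk_weight M (u @ [hd u]) =
        (if successively R (u @ [hd u]) then \<Prod>r\<leftarrow>butlast (u @ [hd u]). w (e r) else 0)"
      by (intro walk_weight_if_successively M_nth)
    ultimately show "cyclic_weight M u =
        (if reduced_cycle G (map e u) then path_weight w (map e u) else 0)"
      by (simp add: cyclic_weight_def path_weight_def o_def)
  qed
  have S0: "fps_nth S 0 = 1"
    using log_deriv_Sdet[OF M] by (simp add: S_def log_deriv_def)
  let ?A = "lyndon_cycles G m e"
  let ?g = "\<lambda>C. quat_norm_poly (path_weight w C) (length C)"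
  have g0: "fps_nth (?g C) 0 = 1" if "C \<in> ?A" for C
    using that by (auto simp: lyndon_cycles_def lyndon_words_def quat_norm_poly_def)
  have factor: "inverse (cycle_series w C * fps_quat_cnj (cycle_series w C)) =
      fps_quat_of_complex (inverse (?g C))" if "C \<in> ?A" for C
  proof -
    have "C \<noteq> []"
      using that by (auto simp: lyndon_cycles_def lyndon_words_def)
    then show ?thesis
      by (simp add: cycle_series_norm fps_quat_of_complex_inverse g0[OF that])
  qed
  have "has_fps_prod (\<lambda>C. inverse (cycle_series w C * fps_quat_cnj (cycle_series w C))) ?A
      (fps_quat_of_complex (inverse S))"
    unfolding has_fps_prod_def
  proof (intro allI)
    fix n
    \<comment> \<open>The witness for coefficient \<open>n\<close> is the set of cycles of length at
      most \<open>n\<close>.\<close>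
    have "finite {C \<in> ?A. length C \<le> n}"
    proof (rule finite_subset)
      show "{C \<in> ?A. length C \<le> n} \<subseteq>
          map e ` {u. set u \<subseteq> {0..<N} \<and> length u \<le> n}"
        by (auto simp: lyndon_cycles_def lyndon_words_def N_def)
    qed (rule finite_imageI, rule finite_lists_length_le, simp)
    moreover have "fps_nth (prod_list (map (\<lambda>C. inverse (cycle_series w C *
        fps_quat_cnj (cycle_series w C))) xs)) n = fps_nth (fps_quat_of_complex (inverse S)) n"
      if xs: "distinct xs \<and> {C \<in> ?A. length C \<le> n} \<subseteq> set xs \<and> set xs \<subseteq> ?A" for xs
    proof -
      \<comment> \<open>The partial product is pulled back to Lyndon words; injectivity of
        \<open>e\<close> on the letters keeps factors from merging.\<close>
      let ?L = "{u \<in> lyndon_words N. map e u \<in> set xs}"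
      have inj: "inj_on (map e) ?L"
      proof (rule inj_on_mapI)
        show "inj_on e (\<Union> (set ` ?L))"
          by (rule inj_on_subset[OF bij_betw_imp_inj_on[OF e]]) (auto simp: lyndon_words_def)
      qed
      have im: "map e ` ?L = set xs"
        using xs by (auto simp: lyndon_cycles_def N_def)
      have "fps_nth (\<Prod>C\<in>set xs. ?g C) k = fps_nth S k" if "k \<le> n" for k
      proof -
        have "(\<Prod>C\<in>set xs. ?g C) = (\<Prod>u\<in>?L. ?g (map e u))"
          using prod.reindex[OF inj, of ?g] by (simp add: im)
        also have "\<dots> = (\<Prod>u\<in>?L. quat_norm_poly (cyclic_weight M u) (length u))"
          using xs weight by (intro prod.cong) (auto simp: lyndon_cycles_def)
        also have "fps_nth \<dots> k = fps_nth S k"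
          unfolding S_def
        proof (rule Sdet_nth_eq_lyndon_prod_nth[OF M _ _ _ that])
          show "finite ?L"
            using finite_imageD[OF _ inj] im by simp
          \<comment> \<open>Nonzero weight makes the word a reduced cycle, and cycles of length at
            most \<open>n\<close> all occur in \<open>xs\<close>.\<close>
          show "u \<in> ?L" if "u \<in> lyndon_words N" "length u \<le> n" "cyclic_weight M u \<noteq> 0" for u
            using that xs weight[of u] by (auto simp: lyndon_cycles_def N_def split: if_splits)
        qed simp
        finally show ?thesis .
      qed
      then have agree: "fps_nth (inverse (\<Prod>C\<in>set xs. ?g C)) n = fps_nth (inverse S) n"
        using S0 by (intro fps_inverse_agree) simp_all
      have "prod_list (map (\<lambda>C. inverse (cycle_series w C * fps_quat_cnj (cycle_series w C))) xs) =
          prod_list (map (\<lambda>C. fps_quat_of_complex (inverse (?g C))) xs)"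
        using xs factor by (intro arg_cong[of _ _ prod_list] map_cong) auto
      also have "\<dots> = fps_quat_of_complex (prod_list (map (\<lambda>C. inverse (?g C)) xs))"
        by (induction xs) (simp_all add: fps_quat_of_complex_1 fps_quat_of_complex_mult)
      \<comment> \<open>Among complex series the factors commute, so the order of \<open>xs\<close>
        disappears.\<close>
      also have "prod_list (map (\<lambda>C. inverse (?g C)) xs) = inverse (\<Prod>C\<in>set xs. ?g C)"
        unfolding inverse_prod_fps using xs by (simp add: prod.distinct_set_conv_list)
      finally show ?thesis
        using agree by (simp add: fps_quat_of_complex_def)
    qed
    ultimately show "\<exists>F. finite F \<and> F \<subseteq> ?A \<and> (\<forall>xs. distinct xs \<and> F \<subseteq> set xs \<and> set xs \<subseteq> ?A \<longrightarrow>
        fps_nth (prod_list (map (\<lambda>C. inverse (cycle_series w C *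
          fps_quat_cnj (cycle_series w C))) xs)) n = fps_nth (fps_quat_of_complex (inverse S)) n)"
      by (intro exI[of _ "{C \<in> ?A. length C \<le> n}"]) blast
  qed
  then have "zeta_H G m e w = fps_quat_of_complex (inverse S)"
    unfolding zeta_H_def by (rule fps_prod_eqI)
  moreover have "inverse (inverse S) = S"
    using S0 by simp
  moreover have "fps_nth (inverse S) 0 = 1"
    using S0 by simp
  ultimately have "inverse (zeta_H G m e w) = fps_quat_of_complex S"
    by (simp flip: fps_quat_of_complex_inverse)
  then show ?thesis
    by (simp only: S_def M_def N_def)
qed

end
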